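(* Let $A$ be a finite associative conformal algebra which is free as a $\mathbb{C}[\partial]$-module and let $r=\sum_ir_i\otimes l_i\in A\otimes A$ be antisymmetric. Let $T^r\in Chom(A^{\ast c},A)$ be given by $T^r_\lambda(f)=\sum_if_{-\lambda-\partial^A}(r_i)l_i$ for $f\in A^{\ast c}$. Then $r$ is a solution of the associative conformal Yang-Baxter equation in $A$ if and only if $T^r$ satisfies $$T^r_0(f)_\lambda T^r_0(g)-T^r_0(R_A^\ast(T^r_0(f))_\lambda g)-T^r_0(L_A^\ast(T^r_0(g))_{-\lambda-\partial}f)=0,\qquad\forall\ f,g\in A^{\ast c}.$$
   Context: Everything is over $\mathbb{C}$. An associative conformal algebra is a $\mathbb{C}[\partial]$-module $A$ with a $\mathbb{C}$-bilinear map $A\times A\to A[\lambda]$, $(a,b)\mapsto a_\lambda b$, such that $(\partial a)_\lambda b=-\lambda a_\lambda b$, $a_\lambda(\partial b)=(\partial+\lambda)(a_\lambda b)$ and $(a_\lambda b)_{\lambda+\mu}c=a_\lambda(b_\mu c)$. Finite means finitely generated as a $\mathbb{C}[\partial]$-module. $Chom(U,V)$: $\mathbb{C}$-linear maps $a_\lambda:U\to V[\lambda]$ with $a_\lambda(\partial u)=(\partial+\lambda)a_\lambda u$, a $\mathbb{C}[\partial]$-module via $(\partial a)_\lambda=-\lambda a_\lambda$; the conformal dual is $A^{\ast c}=Chom(A,\mathbb{C})$, $\mathbb{C}$ with $\partial=0$. In $T^r_\lambda(f)$, $\partial^A$ is the action of $\partial$ on $A$: $f_\nu(r_i)\in\mathbb{C}[\nu]$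 is evaluated at $\nu=-\lambda-\partial$ and applied to $l_i$. $T^r_0=T^r_\lambda|_{\lambda=0}:A^{\ast c}\to A$. $L_A(a)_\lambda b=a_\lambda b$, $R_A(a)_\lambda b=b_{-\lambda-\partial}a$, $(L_A^\ast(a)_\lambda f)_\mu b=f_{\mu-\lambda}(L_A(a)_\lambda b)$, $(R_A^\ast(a)_\lambda f)_\mu b=f_{\mu-\lambda}(R_A(a)_\lambda b)$. An expression $\phi_{-\lambda-\partial}v$ means: write $\phi_\nu v=\sum_k\nu^kc_k$ and take $\sum_k(-\lambda-\partial)^kc_k$, $\partial$ acting on the $c_k$. $r$ is antisymmetric if $\tau r=-r$, $\tau(x\otimes y)=y\otimes x$. Put $\partial^{\otimes^2}=\partial\otimes1+1\otimes\partial$, $\partial^{\otimes^3}=\partial\otimes1\otimes1+1\otimes\partial\otimes1+1\otimes1\otimes\partial$ and $$r\bullet r=\sum_{i,j}\Big(r_i\otimes r_j\otimes{l_i}_\mu l_j\big|_{\mu=\partial\otimes1\otimes1}-r_i\otimes{r_j}_\mu l_i\otimes l_j\big|_{\mu=-\partial^{\otimes^2}\otimes1}+{r_i}_\mu r_j\otimes l_i\otimes l_j\big|_{\mu=1\otimes\partial\otimes1}\Big),$$ where powers of $\mu$ are replaced by powers of the operator acting on the coefficients in $A^{\otimes3}$. The associative conformal Yang-Baxter equation in $A$ is $r\bullet r\equiv0\ \mathrm{mod}\ (\partial^{\otimes^3})$, i.e. $r\bullet r\in\partial^{\otimes^3}(A\otimes A\otimes A)$. *)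

theory Defs
  imports Complex_Main "HOL-Library.Poly_Mapping" "HOL-Computational_Algebra.Polynomial"
begin

section \<open>Complex vector spaces and \<open>\<complex>[\<partial>]\<close>-modules\<close>

class complex_space = ab_group_add +
  fixes scaleC :: "complex \<Rightarrow> 'a \<Rightarrow> 'a" (infixr "*\<^sub>C" 75)
  assumes scaleC_add_right: "c *\<^sub>C (x + y) = c *\<^sub>C x + c *\<^sub>C y"
    and scaleC_add_left: "(c + d) *\<^sub>C x = c *\<^sub>C x + d *\<^sub>C x"
    and scaleC_scaleC: "c *\<^sub>C d *\<^sub>C x = (c * d) *\<^sub>C x"
    and scaleC_one: "1 *\<^sub>C x = x"

global_interpretation cvs: vector_space "scaleC :: complex \<Rightarrow> 'a \<Rightarrow> 'a::complex_space"
  by standard (simp_all add: scaleC_add_right scaleC_add_left scaleC_scaleC scaleC_one)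

abbreviation clinear :: "('a::complex_space \<Rightarrow> 'b::complex_space) \<Rightarrow> bool"
  where "clinear \<equiv> Vector_Spaces.linear scaleC scaleC"

definition cbilinear :: "('a::complex_space \<Rightarrow> 'b::complex_space \<Rightarrow> 'c::complex_space) \<Rightarrow> bool"
  where "cbilinear f \<longleftrightarrow> (\<forall>x. clinear (f x)) \<and> (\<forall>y. clinear (\<lambda>x. f x y))"

lemma clinear_iff:
  "clinear f \<longleftrightarrow> (\<forall>x y. f (x + y) = f x + f y) \<and> (\<forall>c x. f (c *\<^sub>C x) = c *\<^sub>C f x)"
  by (simp add: Vector_Spaces.linear_iff_module_hom module_hom_iff cvs.module_axioms)

lemma clinearI:
  assumes "\<And>x y. f (x + y) = f x + f y" "\<And>c x. f (c *\<^sub>C x) = c *\<^sub>C f x"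
  shows "clinear f"
  using assms by (simp add: clinear_iff)

lemma clinear_add: "clinear f \<Longrightarrow> f (x + y) = f x + f y"
  and clinear_scale: "clinear f \<Longrightarrow> f (c *\<^sub>C x) = c *\<^sub>C f x"
  by (simp_all add: clinear_iff)

lemma clinear_0: "clinear f \<Longrightarrow> f 0 = 0"
  using clinear_add[of f 0 0] by simp

lemma clinear_minus: "clinear f \<Longrightarrow> f (- x) = - f x"
  by (metis add_eq_0_iff clinear_0 clinear_add)

lemma clinear_diff: "clinear f \<Longrightarrow> f (x - y) = f x - f y"
  by (metis clinear_add clinear_minus uminus_add_conv_diff add.commute)

lemma clinear_sum: "clinear f \<Longrightarrow> f (sum g S) = (\<Sum>x\<in>S. f (g x))"
  by (induction S rule: infinite_finite_induct) (simp_all add: clinear_0 clinear_add)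

class dmod = complex_space +
  fixes pd :: "'a \<Rightarrow> 'a"
  assumes pd_add: "pd (x + y) = pd x + pd y"
    and pd_scaleC: "pd (c *\<^sub>C x) = c *\<^sub>C pd x"

lemma clinear_pd: "clinear pd"
  by (intro clinearI pd_add pd_scaleC)

text \<open>\<open>\<complex>\<close> is regarded as a \<open>\<complex>[\<partial>]\<close>-module with \<open>\<partial> = 0\<close>.\<close>

instantiation complex :: dmod
begin
definition scaleC_complex :: "complex \<Rightarrow> complex \<Rightarrow> complex" where "scaleC_complex = (*)"
definition pd_complex :: "complex \<Rightarrow> complex" where "pd_complex z = 0"
instance
  by standard (simp_all add: scaleC_complex_def pd_complex_def algebra_simps)
end

text \<open>
  For a module \<open>V\<close>, \<open>V[\<lambda>]\<close> is \<^typ>\<open>'v poly\<close>: scalars and \<open>\<partial>\<close> act on the coefficients,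
  and multiplication by \<open>\<lambda>\<close> is \<open>pCons 0\<close>.
\<close>

instantiation poly :: (complex_space) complex_space
begin
definition scaleC_poly :: "complex \<Rightarrow> 'a poly \<Rightarrow> 'a poly" where "scaleC_poly c = map_poly (scaleC c)"
instance
  by standard
    (simp_all add: scaleC_poly_def poly_eq_iff coeff_map_poly scaleC_add_right scaleC_add_left
      scaleC_scaleC scaleC_one)
end

lemma coeff_scaleC [simp]: "coeff (c *\<^sub>C p) n = c *\<^sub>C coeff p n"
  by (simp add: scaleC_poly_def coeff_map_poly)

instantiation poly :: (dmod) dmod
begin
definition pd_poly :: "'a poly \<Rightarrow> 'a poly" where "pd_poly = map_poly pd"
instance
  by standard
    (simp_all add: pd_poly_def poly_eq_iff coeff_map_poly pd_add pd_scaleC clinear_0[OF clinear_pd])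
end

lemma coeff_pd [simp]: "coeff (pd p) n = pd (coeff p n)"
  by (simp add: pd_poly_def coeff_map_poly clinear_0[OF clinear_pd])

text \<open>
  Substitution of an operator for the variable: for \<open>p = \<Sum>k. \<nu>\<^sup>k c\<^sub>k\<close>, \<open>psubst \<phi> e p = \<Sum>k. \<phi>\<^sup>k (e c\<^sub>k)\<close>.
  The map \<open>e\<close> places the coefficients into the space on which \<open>\<phi>\<close> acts.
\<close>

definition psubst :: "('b \<Rightarrow> 'b) \<Rightarrow> ('a \<Rightarrow> 'b) \<Rightarrow> 'a::zero poly \<Rightarrow> 'b::ab_group_add"
  where "psubst \<phi> e p = (\<Sum>k\<le>degree p. (\<phi> ^^ k) (e (coeff p k)))"

lemma clinear_funpow: "clinear (f :: 'a::complex_space \<Rightarrow> 'a) \<Longrightarrow> clinear (f ^^ k)"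
  by (induction k) (auto simp: clinear_iff comp_def)

lemma clinear_compose: "clinear f \<Longrightarrow> clinear g \<Longrightarrow> clinear (\<lambda>x. f (g x))"
  by (auto simp: clinear_iff)

lemma clinear_add_fun: "clinear f \<Longrightarrow> clinear g \<Longrightarrow> clinear (\<lambda>x. f x + g x)"
  and clinear_minus_fun: "clinear f \<Longrightarrow> clinear (\<lambda>x. - f x)"
  and clinear_diff_fun: "clinear f \<Longrightarrow> clinear g \<Longrightarrow> clinear (\<lambda>x. f x - g x)"
  and clinear_scale_fun: "clinear f \<Longrightarrow> clinear (\<lambda>x. c *\<^sub>C f x)"
  and clinear_zero_fun: "clinear (\<lambda>x. 0)"
  by (auto simp: clinear_iff scaleC_add_right cvs.scale_right_diff_distrib scaleC_scaleC mult.commute)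

lemma clinear_sum_fun:
  "(\<And>i. i \<in> S \<Longrightarrow> clinear (f i)) \<Longrightarrow> clinear (\<lambda>x. \<Sum>i\<in>S. f i x)"
  by (induction S rule: infinite_finite_induct) (auto intro: clinear_zero_fun clinear_add_fun)

lemma clinear_ident: "clinear (\<lambda>x. x)" and clinear_const_poly: "clinear (\<lambda>c. [:c:])"
  and clinear_pCons: "clinear (pCons 0)"
  and clinear_coeff: "clinear (\<lambda>p. coeff p n)"
  by (auto simp: clinear_iff poly_eq_iff coeff_pCons split: nat.splits)

lemma clinear_map_poly: "clinear f \<Longrightarrow> clinear (map_poly f)"
  by (auto simp: clinear_iff poly_eq_iff coeff_map_poly clinear_0[unfolded clinear_iff])

lemmas clinear_intros = clinear_ident clinear_add_fun clinear_minus_fun clinear_diff_fun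
  clinear_scale_fun clinear_zero_fun clinear_const_poly clinear_pCons clinear_map_poly clinear_pd

lemma psubst_le:
  assumes "clinear \<phi>" "e 0 = 0" "degree p \<le> N"
  shows "psubst \<phi> e p = (\<Sum>k\<le>N. (\<phi> ^^ k) (e (coeff p k)))"
  unfolding psubst_def
  using assms by (intro sum.mono_neutral_left)
    (auto simp: coeff_eq_0 clinear_0[OF clinear_funpow])

lemma clinear_psubst:
  fixes e :: "'a::complex_space \<Rightarrow> 'b::complex_space"
  assumes "clinear \<phi>" "clinear e"
  shows "clinear (psubst \<phi> e)"
proof (rule clinearI)
  note e0 = clinear_0[OF assms(2)]
  note lin = clinear_compose[OF clinear_funpow[OF assms(1)] assms(2)]
  fix p q :: "'a poly" and c
  define N where "N = max (degree p) (degree q)"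
  have "degree (p + q) \<le> N" "degree p \<le> N" "degree q \<le> N"
    by (auto simp: N_def degree_add_le)
  then show "psubst \<phi> e (p + q) = psubst \<phi> e p + psubst \<phi> e q"
    by (simp add: psubst_le[OF assms(1), of e _ N] e0 clinear_add[OF lin] sum.distrib)
  have "degree (c *\<^sub>C p) \<le> degree p"
    by (intro degree_le) (simp add: coeff_eq_0)
  then show "psubst \<phi> e (c *\<^sub>C p) = c *\<^sub>C psubst \<phi> e p"
    by (simp add: psubst_le[OF assms(1), of e _ "degree p"] e0 clinear_scale[OF lin]
        cvs.scale_sum_right)
qed

lemma psubst_fun_add:
  assumes "clinear \<phi>"
  shows "psubst \<phi> (\<lambda>c. e c + e' c) p = psubst \<phi> e p + psubst \<phi> e' p"
  by (simp add: psubst_def clinear_add[OF clinear_funpow[OF assms]] sum.distrib)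

lemma psubst_fun_scale:
  assumes "clinear \<phi>"
  shows "psubst \<phi> (\<lambda>c. a *\<^sub>C e c) p = a *\<^sub>C psubst \<phi> e p"
  by (simp add: psubst_def clinear_scale[OF clinear_funpow[OF assms]] cvs.scale_sum_right)

lemma psubst_pCons:
  assumes "clinear \<phi>" "e 0 = 0"
  shows "psubst \<phi> e (pCons c p) = e c + \<phi> (psubst \<phi> e p)"
proof -
  have "psubst \<phi> e (pCons c p) = (\<Sum>k\<le>Suc (degree p). (\<phi> ^^ k) (e (coeff (pCons c p) k)))"
    using assms degree_pCons_le by (intro psubst_le) auto
  also have "\<dots> = e c + \<phi> (psubst \<phi> e p)"
    by (subst sum.atMost_Suc_shift) (simp add: psubst_def clinear_sum[OF assms(1)])
  finally show ?thesis .
qed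

lemma psubst_comm:
  assumes "clinear \<psi>" "\<And>x. \<psi> (\<phi> x) = \<phi>' (\<psi> x)"
  shows "\<psi> (psubst \<phi> e p) = psubst \<phi>' (\<lambda>c. \<psi> (e c)) p"
proof -
  have "\<psi> ((\<phi> ^^ k) x) = (\<phi>' ^^ k) (\<psi> x)" for k x
    by (induction k) (simp_all add: assms(2))
  then show ?thesis
    by (simp add: psubst_def clinear_sum[OF assms(1)])
qed

lemma psubst_map_poly:
  assumes "clinear \<phi>" "h 0 = 0" "e 0 = 0"
  shows "psubst \<phi> e (map_poly h p) = psubst \<phi> (\<lambda>c. e (h c)) p"
proof -
  have "degree (map_poly h p) \<le> degree p"
    by (rule degree_le) (simp add: coeff_map_poly assms(2) coeff_eq_0)
  then show ?thesis
    using assms by (simp add: psubst_le[OF assms(1), of _ _ "degree p"] coeff_map_poly)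
qed

text \<open>
  The \<open>\<complex>[\<partial>]\<close>-module structure determined by \<open>\<partial>\<close>; finite generation and freeness of a module are
  expressed through \<open>dm.span\<close> and \<open>dm.independent\<close> below.
\<close>

definition dscale :: "complex poly \<Rightarrow> 'a::dmod \<Rightarrow> 'a"
  where "dscale p a = psubst pd (\<lambda>c. c *\<^sub>C a) p"

lemma dscale_0 [simp]: "dscale 0 a = 0"
  by (simp add: dscale_def psubst_def)

lemma dscale_pCons: "dscale (pCons c p) a = c *\<^sub>C a + pd (dscale p a)"
  unfolding dscale_def by (rule psubst_pCons) (auto intro: clinear_pd)

lemma clinear_dscale: "clinear (dscale p)"
proof (induction p)
  case (pCons c p)
  then show ?case
    by (auto simp: clinear_iff dscale_pCons scaleC_add_right pd_add pd_scaleC scaleC_scaleC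
        mult.commute algebra_simps)
qed (simp add: clinear_iff)

lemma dscale_pd: "dscale p (pd a) = pd (dscale p a)"
  by (induction p) (simp_all add: dscale_pCons pd_add pd_scaleC clinear_0[OF clinear_pd])

lemma dscale_add_left: "dscale (p + q) a = dscale p a + dscale q a"
proof (induction p arbitrary: q)
  case (pCons c p)
  note IH = pCons.IH
  show ?case
  proof (cases q rule: pCons_cases)
    case (pCons d q')
    then show ?thesis
      by (simp add: dscale_pCons IH scaleC_add_left pd_add algebra_simps)
  qed
qed simp

global_interpretation dm: module "dscale :: complex poly \<Rightarrow> 'a \<Rightarrow> 'a::dmod"
proof
  fix p q :: "complex poly" and a b :: 'a
  show "dscale p (a + b) = dscale p a + dscale p b"
    by (rule clinear_add[OF clinear_dscale])
  show "dscale (p + q) a = dscale p a + dscale q a"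
    by (rule dscale_add_left)
  have sm: "dscale (smult c q) a = c *\<^sub>C dscale q a" for c
    by (induction q) (simp_all add: dscale_pCons scaleC_add_right scaleC_scaleC pd_scaleC)
  show "dscale p (dscale q a) = dscale (p * q) a"
    by (induction p) (simp_all add: dscale_pCons dscale_add_left sm)
  show "dscale 1 a = a"
    by (simp add: one_pCons dscale_pCons scaleC_one clinear_0[OF clinear_pd])
qed


section \<open>Tensor products over \<open>\<complex>\<close>\<close>

abbreviation free_scale :: "complex \<Rightarrow> ('k \<Rightarrow>\<^sub>0 complex) \<Rightarrow> ('k \<Rightarrow>\<^sub>0 complex)"
  where "free_scale c \<equiv> Poly_Mapping.map ((*) c)"

lemma lookup_free_scale [simp]: "Poly_Mapping.lookup (free_scale c p) k = c * Poly_Mapping.lookup p k"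
  by (simp add: Poly_Mapping.map.rep_eq when_def)

global_interpretation free: vector_space "free_scale :: complex \<Rightarrow> ('k \<Rightarrow>\<^sub>0 complex) \<Rightarrow> _"
  by standard (simp_all add: poly_mapping_eq_iff fun_eq_iff Poly_Mapping.lookup_add algebra_simps)

definition tensor_relators :: "(('a::complex_space \<times> 'b::complex_space) \<Rightarrow>\<^sub>0 complex) set" where
  "tensor_relators =
     {Poly_Mapping.single (a + a', b) 1 - Poly_Mapping.single (a, b) 1
        - Poly_Mapping.single (a', b) 1 | a a' b. True} \<union>
     {Poly_Mapping.single (a, b + b') 1 - Poly_Mapping.single (a, b) 1
        - Poly_Mapping.single (a, b') 1 | a b b'. True} \<union>
     {Poly_Mapping.single (c *\<^sub>C a, b) 1 - Poly_Mapping.single (a, b) c | a b c. True} \<union>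
     {Poly_Mapping.single (a, c *\<^sub>C b) 1 - Poly_Mapping.single (a, b) c | a b c. True}"

definition tensor_eq ::
  "(('a::complex_space \<times> 'b::complex_space) \<Rightarrow>\<^sub>0 complex) \<Rightarrow> (('a \<times> 'b) \<Rightarrow>\<^sub>0 complex) \<Rightarrow> bool"
  where "tensor_eq x y \<longleftrightarrow> x - y \<in> free.span tensor_relators"

quotient_type (overloaded) ('a, 'b) tensor =
  "('a::complex_space \<times> 'b::complex_space) \<Rightarrow>\<^sub>0 complex" / tensor_eq
proof (rule equivpI)
  show "reflp tensor_eq"
    by (simp add: reflp_def tensor_eq_def free.span_zero)
  show "symp tensor_eq"
    unfolding symp_def tensor_eq_def by (metis free.span_neg minus_diff_eq)
  show "transp tensor_eq"
    unfolding transp_def tensor_eq_def using free.span_add by fastforce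
qed

instantiation tensor :: (complex_space, complex_space) complex_space
begin

lift_definition zero_tensor :: "('a, 'b) tensor" is 0 .

lift_definition plus_tensor :: "('a, 'b) tensor \<Rightarrow> ('a, 'b) tensor \<Rightarrow> ('a, 'b) tensor" is "(+)"
  unfolding tensor_eq_def by (metis add_diff_add free.span_add)

lift_definition uminus_tensor :: "('a, 'b) tensor \<Rightarrow> ('a, 'b) tensor" is uminus
  unfolding tensor_eq_def by (metis free.span_neg minus_diff_minus)

lift_definition minus_tensor :: "('a, 'b) tensor \<Rightarrow> ('a, 'b) tensor \<Rightarrow> ('a, 'b) tensor" is "(-)"
proof -
  fix a b c d :: "('a \<times> 'b) \<Rightarrow>\<^sub>0 complex"
  assume "tensor_eq a b" "tensor_eq c d"
  moreover have "(a - c) - (b - d) = (a - b) - (c - d)"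
    by simp
  ultimately show "tensor_eq (a - c) (b - d)"
    unfolding tensor_eq_def by (metis free.span_diff)
qed

lift_definition scaleC_tensor :: "complex \<Rightarrow> ('a, 'b) tensor \<Rightarrow> ('a, 'b) tensor" is free_scale
  unfolding tensor_eq_def by (metis free.span_scale free.scale_right_diff_distrib)

instance
proof
  fix x y z :: "('a, 'b) tensor" and c d :: complex
  have eq: "tensor_eq p q" if "p = q" for p q :: "('a \<times> 'b) \<Rightarrow>\<^sub>0 complex"
    using that by (simp add: tensor_eq_def free.span_zero)
  show "x + y + z = x + (y + z)" by transfer (rule eq, simp)
  show "x + y = y + x" by transfer (rule eq, simp)
  show "0 + x = x" by transfer (rule eq, simp)
  show "- x + x = 0" by transfer (rule eq, simp)
  show "x - y = x + - y" by transfer (rule eq, simp)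
  show "c *\<^sub>C (x + y) = c *\<^sub>C x + c *\<^sub>C y"
    by transfer (rule eq, rule free.scale_right_distrib)
  show "(c + d) *\<^sub>C x = c *\<^sub>C x + d *\<^sub>C x"
    by transfer (rule eq, rule free.scale_left_distrib)
  show "c *\<^sub>C d *\<^sub>C x = (c * d) *\<^sub>C x"
    by transfer (rule eq, rule free.scale_scale)
  show "1 *\<^sub>C x = x"
    by transfer (rule eq, rule free.scale_one)
qed

end

lift_definition tens :: "'a::complex_space \<Rightarrow> 'b::complex_space \<Rightarrow> ('a, 'b) tensor" (infixr "\<otimes>" 70)
  is "\<lambda>a b. Poly_Mapping.single (a, b) 1" .

lemma cbilinear_tens: "cbilinear (\<otimes>)"
proof -
  have s: "free_scale c (Poly_Mapping.single k 1) = Poly_Mapping.single k c" for c and k :: "'a \<times> 'b"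
    by (simp add: poly_mapping_eq_iff fun_eq_iff Poly_Mapping.lookup_single when_def)
  have 1: "a \<otimes> (b + b') = a \<otimes> b + a \<otimes> b'" for a :: 'a and b b' :: 'b
    by transfer (unfold tensor_eq_def diff_diff_eq[symmetric],
      rule free.span_base, unfold tensor_relators_def, blast)
  have 2: "(a + a') \<otimes> b = a \<otimes> b + a' \<otimes> b" for a a' :: 'a and b :: 'b
    by transfer (unfold tensor_eq_def diff_diff_eq[symmetric],
      rule free.span_base, unfold tensor_relators_def, blast)
  have 3: "a \<otimes> (c *\<^sub>C b) = c *\<^sub>C (a \<otimes> b)" for a :: 'a and b :: 'b and c
    by transfer (unfold tensor_eq_def s, rule free.span_base, unfold tensor_relators_def, blast)
  have 4: "(c *\<^sub>C a) \<otimes> b = c *\<^sub>C (a \<otimes> b)" for a :: 'a and b :: 'b and c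
    by transfer (unfold tensor_eq_def s, rule free.span_base, unfold tensor_relators_def, blast)
  show ?thesis
    by (simp add: cbilinear_def clinear_iff 1 2 3 4)
qed

text \<open>
  The linear map \<open>A \<otimes> B \<rightarrow> C\<close> induced by a bilinear map \<open>A \<times> B \<rightarrow> C\<close>;
  see \<open>tensor_lift_tens\<close> and \<open>clinear_tensor_lift\<close>.
\<close>

definition free_lift ::
  "('a \<Rightarrow> 'b \<Rightarrow> 'c::complex_space) \<Rightarrow> (('a \<times> 'b) \<Rightarrow>\<^sub>0 complex) \<Rightarrow> 'c"
  where "free_lift f p = (\<Sum>k\<in>Poly_Mapping.keys p. Poly_Mapping.lookup p k *\<^sub>C f (fst k) (snd k))"

definition tensor_lift ::
  "('a::complex_space \<Rightarrow> 'b::complex_space \<Rightarrow> 'c::complex_space) \<Rightarrow> ('a, 'b) tensor \<Rightarrow> 'c"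
  where "tensor_lift f t = free_lift f (rep_tensor t)"

lemma free_lift_superset:
  assumes "finite S" "Poly_Mapping.keys p \<subseteq> S"
  shows "free_lift f p = (\<Sum>k\<in>S. Poly_Mapping.lookup p k *\<^sub>C f (fst k) (snd k))"
  unfolding free_lift_def using assms
  by (intro sum.mono_neutral_left) (auto simp: in_keys_iff)

lemma free_lift_add: "free_lift f (p + q) = free_lift f p + free_lift f q"
proof -
  let ?S = "Poly_Mapping.keys p \<union> Poly_Mapping.keys q"
  show ?thesis
    using Poly_Mapping.keys_add[of p q]
    by (simp add: free_lift_superset[of ?S] Poly_Mapping.lookup_add scaleC_add_left sum.distrib)
qed

lemma free_lift_scale: "free_lift f (free_scale c p) = c *\<^sub>C free_lift f p"
proof -
  have "Poly_Mapping.keys (free_scale c p) \<subseteq> Poly_Mapping.keys p"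
    by (auto simp: in_keys_iff)
  then show ?thesis
    by (simp add: free_lift_superset[of "Poly_Mapping.keys p"] cvs.scale_sum_right scaleC_scaleC)
qed

lemma free_lift_single: "free_lift f (Poly_Mapping.single (a, b) c) = c *\<^sub>C f a b"
  by (simp add: free_lift_def)

lemma free_lift_diff: "free_lift f (p - q) = free_lift f p - free_lift f q"
  using free_lift_add[of f "p - q" q] by simp

lemma free_lift_cong:
  assumes f: "cbilinear f" and "tensor_eq p q"
  shows "free_lift f p = free_lift f q"
proof -
  have lin: "clinear (f x)" "clinear (\<lambda>x. f x y)" for x y
    using f by (simp_all add: cbilinear_def)
  have "free_lift f x = 0" if "x \<in> free.span tensor_relators" for x
    using that
  proof (induction rule: free.span_induct_alt)
    case base
    show ?case by (simp add: free_lift_def)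
  next
    case (step c x y)
    from step(1) have "free_lift f x = 0"
      unfolding tensor_relators_def
      by (auto simp: free_lift_diff free_lift_single scaleC_one clinear_add[OF lin(1)]
          clinear_add[OF lin(2)] clinear_scale[OF lin(1)] clinear_scale[OF lin(2)])
    then show ?case
      using step(2) by (simp add: free_lift_add free_lift_scale)
  qed
  from this[OF assms(2)[unfolded tensor_eq_def]] show ?thesis
    by (simp add: free_lift_diff)
qed

lemma tensor_lift_abs:
  assumes "cbilinear f"
  shows "tensor_lift f (abs_tensor p) = free_lift f p"
  unfolding tensor_lift_def
  by (rule free_lift_cong[OF assms]) (metis Quotient_rep_abs[OF Quotient_tensor] equivp_reflp[OF tensor_equivp])

lemma tensor_lift_tens:
  assumes "cbilinear f"
  shows "tensor_lift f (a \<otimes> b) = f a b"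
  by (simp add: tens.abs_eq tensor_lift_abs[OF assms] free_lift_single scaleC_one)

lemma clinear_tensor_lift:
  assumes "cbilinear f"
  shows "clinear (tensor_lift f)"
proof (rule clinearI)
  fix x y :: "('a, 'b) tensor" and c
  obtain p q where pq: "x = abs_tensor p" "y = abs_tensor q"
    by (metis Quotient_abs_rep[OF Quotient_tensor])
  show "tensor_lift f (x + y) = tensor_lift f x + tensor_lift f y"
    by (simp add: pq plus_tensor.abs_eq tensor_lift_abs[OF assms] free_lift_add)
  show "tensor_lift f (c *\<^sub>C x) = c *\<^sub>C tensor_lift f x"
    by (simp add: pq scaleC_tensor.abs_eq tensor_lift_abs[OF assms] free_lift_scale)
qed

definition tensor_map ::
  "('a::complex_space \<Rightarrow> 'c::complex_space) \<Rightarrow> ('b::complex_space \<Rightarrow> 'd::complex_space) \<Rightarrow>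
   ('a, 'b) tensor \<Rightarrow> ('c, 'd) tensor"
  where "tensor_map g h = tensor_lift (\<lambda>a b. g a \<otimes> h b)"

definition tensor_swap :: "('a::complex_space, 'b::complex_space) tensor \<Rightarrow> ('b, 'a) tensor"
  where "tensor_swap = tensor_lift (\<lambda>a b. b \<otimes> a)"

lemma tensor_map_tens:
  assumes "clinear g" "clinear h"
  shows "tensor_map g h (a \<otimes> b) = g a \<otimes> h b"
proof -
  have "cbilinear (\<lambda>a b. g a \<otimes> h b)"
    using cbilinear_tens assms by (auto simp: cbilinear_def clinear_iff)
  then show ?thesis
    by (simp add: tensor_map_def tensor_lift_tens)
qed

lemma tensor_swap_tens:
  fixes a :: "'a::complex_space" and b :: "'b::complex_space"
  shows "tensor_swap (a \<otimes> b) = b \<otimes> a"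
proof -
  have "cbilinear (\<lambda>(a::'a) (b::'b). b \<otimes> a)"
    using cbilinear_tens[where ?'a = 'b and ?'b = 'a] by (auto simp: cbilinear_def)
  then show ?thesis
    by (simp add: tensor_swap_def tensor_lift_tens)
qed


section \<open>Conformal linear maps\<close>

typedef (overloaded) ('u, 'v) Chom =
  "{a :: 'u::dmod \<Rightarrow> 'v::dmod poly. clinear a \<and> (\<forall>u. a (pd u) = pd (a u) + pCons 0 (a u))}"
  morphisms cap Chom
  by (rule exI[of _ "\<lambda>_. 0"]) (simp add: clinear_iff clinear_0[OF clinear_pd])

text \<open>\<open>cap a u\<close> is \<open>a\<^sub>\<lambda> u\<close>.\<close>

setup_lifting type_definition_Chom

instantiation Chom :: (dmod, dmod) dmod
begin

lift_definition zero_Chom :: "('a, 'b) Chom" is "\<lambda>_. 0"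
  by (simp add: clinear_iff clinear_0[OF clinear_pd])

lift_definition plus_Chom :: "('a, 'b) Chom \<Rightarrow> ('a, 'b) Chom \<Rightarrow> ('a, 'b) Chom" is "\<lambda>a b u. a u + b u"
  by (auto intro: clinear_add_fun simp: pd_add)

lift_definition uminus_Chom :: "('a, 'b) Chom \<Rightarrow> ('a, 'b) Chom" is "\<lambda>a u. - a u"
  by (auto intro: clinear_minus_fun simp: clinear_minus[OF clinear_pd])

lift_definition minus_Chom :: "('a, 'b) Chom \<Rightarrow> ('a, 'b) Chom \<Rightarrow> ('a, 'b) Chom" is "\<lambda>a b u. a u - b u"
  by (auto intro: clinear_diff_fun simp: clinear_diff[OF clinear_pd])

lift_definition scaleC_Chom :: "complex \<Rightarrow> ('a, 'b) Chom \<Rightarrow> ('a, 'b) Chom" is "\<lambda>c a u. c *\<^sub>C a u"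
  by (auto intro: clinear_scale_fun simp: pd_scaleC scaleC_add_right clinear_scale[OF clinear_pCons])

lift_definition pd_Chom :: "('a, 'b) Chom \<Rightarrow> ('a, 'b) Chom" is "\<lambda>a u. - pCons 0 (a u)"
  by (auto intro!: clinear_minus_fun clinear_compose[OF clinear_pCons]
      simp: poly_eq_iff coeff_pCons pd_add clinear_minus[OF clinear_pd] clinear_0[OF clinear_pd]
      split: nat.splits)

instance
  by standard
    (simp_all add: cap_inject[symmetric] zero_Chom.rep_eq plus_Chom.rep_eq uminus_Chom.rep_eq
      minus_Chom.rep_eq scaleC_Chom.rep_eq pd_Chom.rep_eq fun_eq_iff scaleC_add_right
      scaleC_add_left scaleC_scaleC scaleC_one clinear_scale[OF clinear_pCons, symmetric])

end

type_synonym 'a cdual = "('a, complex) Chom"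

text \<open>
  The substitution \<open>\<phi>\<^sub>\<nu> v \<mapsto> \<phi>\<^bsub>-\<lambda>-\<partial>\<^esub> v\<close> on \<open>V[\<nu>] \<rightarrow> V[\<lambda>]\<close>.
\<close>

definition neg_lam_pd :: "'v::dmod poly \<Rightarrow> 'v poly"
  where "neg_lam_pd q = - pCons 0 q - pd q"

definition flip :: "'v::dmod poly \<Rightarrow> 'v poly"
  where "flip p = psubst neg_lam_pd (\<lambda>c. [:c:]) p"

lemma clinear_neg_lam_pd: "clinear neg_lam_pd"
  unfolding neg_lam_pd_def by (intro clinear_intros)

lemma clinear_flip: "clinear flip"
  unfolding flip_def by (intro clinear_psubst clinear_neg_lam_pd clinear_const_poly)

text \<open>
  \<open>V[\<lambda>,\<mu>]\<close> is \<^typ>\<open>'v poly poly\<close> with outer variable \<open>\<lambda>\<close> and inner variable \<open>\<mu>\<close>.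
\<close>

abbreviation mul_lam :: "'v::dmod poly poly \<Rightarrow> 'v poly poly" where "mul_lam \<equiv> pCons 0"
abbreviation mul_mu :: "'v::dmod poly poly \<Rightarrow> 'v poly poly" where "mul_mu \<equiv> map_poly (pCons 0)"


section \<open>Associative conformal algebras\<close>

text \<open>
  In \<open>lprod_assoc\<close>, with \<open>a\<^sub>\<lambda> b = \<Sum>n. \<lambda>\<^sup>n d\<^sub>n\<close> the left-hand side is \<open>\<Sum>n. \<lambda>\<^sup>n (d\<^sub>n)\<^bsub>\<lambda>+\<mu>\<^esub> c\<close>,
  and with \<open>b\<^sub>\<mu> c = \<Sum>n. \<mu>\<^sup>n d\<^sub>n\<close> the right-hand side is \<open>\<Sum>n. \<mu>\<^sup>n (a\<^sub>\<lambda> d\<^sub>n)\<close>.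
\<close>

locale assoc_conformal_algebra =
  fixes lprod :: "'a::dmod \<Rightarrow> 'a \<Rightarrow> 'a poly"
  assumes lprod_bilinear: "cbilinear lprod"
    and lprod_pd_left: "lprod (pd a) b = - pCons 0 (lprod a b)"
    and lprod_pd_right: "lprod a (pd b) = pd (lprod a b) + pCons 0 (lprod a b)"
    and lprod_assoc:
      "psubst mul_lam (\<lambda>d. psubst (\<lambda>X. mul_lam X + mul_mu X) (\<lambda>e. [:[:e:]:]) (lprod d c)) (lprod a b) =
       psubst mul_mu (\<lambda>d. map_poly (\<lambda>e. [:e:]) (lprod a d)) (lprod b c)"

definition L_A :: "('a::dmod \<Rightarrow> 'a \<Rightarrow> 'a poly) \<Rightarrow> 'a \<Rightarrow> ('a, 'a) Chom"
  where "L_A lprod a = Chom (\<lambda>b. lprod a b)"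

definition R_A :: "('a::dmod \<Rightarrow> 'a \<Rightarrow> 'a poly) \<Rightarrow> 'a \<Rightarrow> ('a, 'a) Chom"
  where "R_A lprod a = Chom (\<lambda>b. flip (lprod b a))"

context assoc_conformal_algebra
begin

lemma cap_L_A: "cap (L_A lprod a) b = lprod a b"
  unfolding L_A_def using lprod_bilinear
  by (subst Chom_inverse) (auto simp: lprod_pd_right cbilinear_def)

lemma cap_R_A: "cap (R_A lprod a) b = flip (lprod b a)"
proof -
  have "clinear (\<lambda>b. lprod b a)"
    using lprod_bilinear by (simp add: cbilinear_def)
  then have 1: "clinear (\<lambda>b. flip (lprod b a))"
    by (rule clinear_compose[OF clinear_flip])
  have "flip (pCons 0 p) = - pCons 0 (flip p) - pd (flip p)" for p :: "'a poly"
    by (simp add: flip_def psubst_pCons[OF clinear_neg_lam_pd] neg_lam_pd_def)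
  then have 2: "flip (lprod (pd b) a) = pd (flip (lprod b a)) + pCons 0 (flip (lprod b a))" for b
    by (simp add: lprod_pd_left clinear_minus[OF clinear_flip] clinear_minus[OF clinear_pd])
  show ?thesis
    unfolding R_A_def using 1 2 by (subst Chom_inverse) auto
qed

end

text \<open>
  \<open>dual_val \<phi> f b\<close> is \<open>f\<^bsub>\<mu>-\<lambda>\<^esub>(\<phi>\<^sub>\<lambda> b) \<in> \<complex>[\<lambda>,\<mu>]\<close>. Reading it for all \<open>b\<close> simultaneously as a
  polynomial in \<open>\<lambda>\<close> whose coefficients are the functionals \<open>b \<mapsto> coeff (dual_val \<phi> f b) n \<in> \<complex>[\<mu>]\<close>
  gives \<open>dual_act \<phi> f = \<phi>\<^sup>*\<^sub>\<lambda> f \<in> A\<^bsup>*c\<^esup>[\<lambda>]\<close>. The degree in \<open>\<lambda>\<close> is bounded independently of \<open>b\<close> because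
  \<open>A\<close> is finitely generated; see \<open>cap_dual_act\<close>.
\<close>

definition dual_val :: "('a::dmod, 'a) Chom \<Rightarrow> 'a cdual \<Rightarrow> 'a \<Rightarrow> complex poly poly"
  where "dual_val \<phi> f b =
    psubst mul_lam (\<lambda>c. psubst (\<lambda>X. mul_mu X - mul_lam X) (\<lambda>z. [:[:z:]:]) (cap f c)) (cap \<phi> b)"

definition dual_act :: "('a::dmod, 'a) Chom \<Rightarrow> 'a cdual \<Rightarrow> 'a cdual poly"
  where "dual_act \<phi> f = Abs_poly (\<lambda>n. Chom (\<lambda>b. coeff (dual_val \<phi> f b) n))"

lemma clinear_cap: "clinear (cap \<phi>)"
  and cap_pd: "cap \<phi> (pd u) = pd (cap \<phi> u) + pCons 0 (cap \<phi> u)"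
  using cap[of \<phi>] by auto

lemma clinear_dual_val: "clinear (dual_val \<phi> f)"
  unfolding dual_val_def
  by (intro clinear_compose[OF clinear_psubst clinear_cap] clinear_compose[OF clinear_psubst]
      clinear_compose[OF clinear_const_poly clinear_const_poly] clinear_intros clinear_cap)

lemma dual_val_pd: "dual_val \<phi> f (pd b) = mul_mu (dual_val \<phi> f b)"
proof -
  define \<psi> where "\<psi> = (\<lambda>X::complex poly poly. mul_mu X - mul_lam X)"
  define E where "E = (\<lambda>c. psubst \<psi> (\<lambda>z. [:[:z:]:]) (cap f c))"
  define P where "P = psubst mul_lam E"
  have val: "dual_val \<phi> f b = P (cap \<phi> b)" for b
    by (simp add: dual_val_def P_def E_def \<psi>_def)
  have lin: "clinear \<psi>"
    unfolding \<psi>_def by (intro clinear_intros)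
  have linE: "clinear E"
    unfolding E_def
    by (intro clinear_compose[OF clinear_psubst clinear_cap] lin
        clinear_compose[OF clinear_const_poly clinear_const_poly])
  have linP: "clinear P"
    unfolding P_def by (intro clinear_psubst linE clinear_pCons)
  have "pd q = 0" for q :: "complex poly"
    by (simp add: poly_eq_iff pd_complex_def)
  then have Epd: "E (pd c) = \<psi> (E c)" for c
    by (simp add: E_def cap_pd psubst_pCons[OF lin])
  have "P (pd p) = psubst mul_lam (\<lambda>c. \<psi> (E c)) p" for p
    unfolding P_def pd_poly_def
    by (subst psubst_map_poly) (simp_all add: clinear_pCons Epd clinear_0[OF clinear_pd] clinear_0[OF linE])
  also have "\<dots> p = \<psi> (P p)" for p
    unfolding P_def
    by (subst psubst_comm[OF lin, where \<phi>' = mul_lam]) (simp_all add: \<psi>_def map_poly_pCons)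
  finally have "P (pd p) = \<psi> (P p)" for p .
  moreover have "P (pCons 0 p) = mul_lam (P p)" for p
    by (simp add: P_def psubst_pCons[OF clinear_pCons] clinear_0[OF linE])
  ultimately show ?thesis
    by (simp add: val cap_pd clinear_add[OF linP] \<psi>_def)
qed

lemma cap_dual_act:
  fixes \<phi> :: "('a::dmod, 'a) Chom"
  assumes fin: "finite S" "dm.span S = (UNIV :: 'a set)"
  shows "cap (coeff (dual_act \<phi> f) n) b = coeff (dual_val \<phi> f b) n"
proof -
  define F where "F n b = coeff (dual_val \<phi> f b) n" for n b
  have lin: "clinear (F n)" for n
    unfolding F_def by (intro clinear_compose[OF clinear_coeff clinear_dual_val])
  have Fpd: "F n (pd b) = pCons 0 (F n b)" for n b
    by (simp add: F_def dual_val_pd coeff_map_poly)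
  have "pd q = 0" for q :: "complex poly"
    by (simp add: poly_eq_iff pd_complex_def)
  then have mem: "F n \<in> {a. clinear a \<and> (\<forall>u. a (pd u) = pd (a u) + pCons 0 (a u))}" for n
    using lin Fpd by simp
  define N where "N = Max (insert 0 ((\<lambda>s. degree (dual_val \<phi> f s)) ` S))"
  have zero: "F n b = 0" if "n > N" for n b
  proof -
    have "F n (dscale p s) = 0" if "s \<in> S" for p s
    proof (induction p)
      case 0
      then show ?case by (simp add: clinear_0[OF lin])
    next
      case (pCons c p)
      have "degree (dual_val \<phi> f s) \<le> N"
        using that fin by (auto simp: N_def)
      then have "F n s = 0"
        using \<open>n > N\<close> by (simp add: F_def coeff_eq_0)
      with pCons show ?case
        by (simp add: dscale_pCons clinear_add[OF lin] clinear_scale[OF lin] Fpd)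
    qed
    note gens = this
    have "b \<in> dm.span S"
      by (simp add: fin)
    then show ?thesis
    proof (induction rule: dm.span_induct_alt)
      case base
      show ?case by (rule clinear_0[OF lin])
    next
      case (step p s y)
      then show ?case by (simp add: clinear_add[OF lin] gens)
    qed
  qed
  have "Chom (F n) = 0" if "n > N" for n
  proof -
    have "F n = (\<lambda>_. 0)"
      using zero[OF that] by (rule ext)
    then show ?thesis
      by (simp only: zero_Chom_def)
  qed
  then have "\<forall>\<^sub>\<infinity>n. Chom (F n) = 0"
    unfolding MOST_nat by blast
  then have "coeff (dual_act \<phi> f) n = Chom (F n)"
    unfolding dual_act_def F_def by (subst Abs_poly_inverse) auto
  then show ?thesis
    using Chom_inverse[OF mem[of n]] by (simp add: F_def)
qed


section \<open>The Yang-Baxter equation and the operator \<open>T\<^sup>r\<close>\<close>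

text \<open>
  An element \<open>r \<in> A \<otimes> A\<close> enters through a presentation \<open>r = \<Sum>i<n. x\<^sub>i \<otimes> l\<^sub>i\<close>.
  \<open>cap (T_op n x l) f\<close> is \<open>T\<^sup>r\<^sub>\<lambda>(f) = \<Sum>i<n. f\<^bsub>-\<lambda>-\<partial>\<^esub>(x\<^sub>i) l\<^sub>i\<close>: a coefficient \<open>c\<close> of \<open>f\<^sub>\<nu>(x\<^sub>i)\<close>
  is placed in \<open>A[\<lambda>]\<close> as \<open>c l\<^sub>i\<close> and the powers of \<open>\<nu>\<close> become powers of \<open>-\<lambda>-\<partial>\<close>.
\<close>

lift_definition T_op :: "nat \<Rightarrow> (nat \<Rightarrow> 'a::dmod) \<Rightarrow> (nat \<Rightarrow> 'a) \<Rightarrow> ('a cdual, 'a) Chom"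
  is "\<lambda>n x l f. \<Sum>i<n. psubst neg_lam_pd (\<lambda>c. [:c *\<^sub>C l i:]) (cap f (x i))"
proof (intro CollectI conjI allI)
  fix n and x l :: "nat \<Rightarrow> 'a"
  have e: "clinear (\<lambda>c. [:c *\<^sub>C l i:])" for i
    by (rule clinearI) (auto simp: scaleC_add_left poly_eq_iff coeff_pCons scaleC_complex_def
        scaleC_scaleC split: nat.splits)
  note P = clinear_psubst[OF clinear_neg_lam_pd e]
  have c: "clinear (\<lambda>f. cap f u)" for u :: 'a
    by (auto simp: clinear_iff plus_Chom.rep_eq scaleC_Chom.rep_eq)
  show "clinear (\<lambda>f. \<Sum>i<n. psubst neg_lam_pd (\<lambda>c. [:c *\<^sub>C l i:]) (cap f (x i)))"
    by (intro clinear_sum_fun clinear_compose[OF P c])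
  fix f
  have "psubst neg_lam_pd (\<lambda>c. [:c *\<^sub>C l i:]) (- pCons 0 q) =
      pd (psubst neg_lam_pd (\<lambda>c. [:c *\<^sub>C l i:]) q)
        + pCons 0 (psubst neg_lam_pd (\<lambda>c. [:c *\<^sub>C l i:]) q)" for i q
    by (subst clinear_minus[OF P]) (simp add: psubst_pCons[OF clinear_neg_lam_pd] neg_lam_pd_def)
  then show "(\<Sum>i<n. psubst neg_lam_pd (\<lambda>c. [:c *\<^sub>C l i:]) (cap (pd f) (x i))) =
      pd (\<Sum>i<n. psubst neg_lam_pd (\<lambda>c. [:c *\<^sub>C l i:]) (cap f (x i)))
        + pCons 0 (\<Sum>i<n. psubst neg_lam_pd (\<lambda>c. [:c *\<^sub>C l i:]) (cap f (x i)))"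
    by (simp add: pd_Chom.rep_eq sum.distrib clinear_sum[OF clinear_pd] clinear_sum[OF clinear_pCons])
qed

definition T0 :: "nat \<Rightarrow> (nat \<Rightarrow> 'a::dmod) \<Rightarrow> (nat \<Rightarrow> 'a) \<Rightarrow> 'a cdual \<Rightarrow> 'a"
  where "T0 n x l f = coeff (cap (T_op n x l) f) 0"

type_synonym 'a tensor3 = "('a, ('a, 'a) tensor) tensor"

definition pd1 :: "'a::dmod tensor3 \<Rightarrow> 'a tensor3"
  where "pd1 = tensor_map pd (\<lambda>u. u)"
definition pd2 :: "'a::dmod tensor3 \<Rightarrow> 'a tensor3"
  where "pd2 = tensor_map (\<lambda>u. u) (tensor_map pd (\<lambda>u. u))"
definition pd3 :: "'a::dmod tensor3 \<Rightarrow> 'a tensor3"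
  where "pd3 = tensor_map (\<lambda>u. u) (tensor_map (\<lambda>u. u) pd)"

lemma pd123_tens:
  "pd1 (a \<otimes> b \<otimes> c) = pd a \<otimes> b \<otimes> c"
  "pd2 (a \<otimes> b \<otimes> c) = a \<otimes> pd b \<otimes> c"
  "pd3 (a \<otimes> b \<otimes> c) = a \<otimes> b \<otimes> pd c"
proof -
  have lin: "clinear (tensor_map g h)" if "clinear g" "clinear h" for g h :: "'a \<Rightarrow> 'a"
    unfolding tensor_map_def using cbilinear_tens that
    by (intro clinear_tensor_lift) (auto simp: cbilinear_def clinear_iff)
  show "pd1 (a \<otimes> b \<otimes> c) = pd a \<otimes> b \<otimes> c" "pd2 (a \<otimes> b \<otimes> c) = a \<otimes> pd b \<otimes> c"
    "pd3 (a \<otimes> b \<otimes> c) = a \<otimes> b \<otimes> pd c"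
    by (simp_all add: pd1_def pd2_def pd3_def tensor_map_tens lin clinear_pd clinear_ident)
qed

definition bullet ::
  "('a::dmod \<Rightarrow> 'a \<Rightarrow> 'a poly) \<Rightarrow> nat \<Rightarrow> (nat \<Rightarrow> 'a) \<Rightarrow> (nat \<Rightarrow> 'a) \<Rightarrow> 'a tensor3"
  where "bullet lprod n x l = (\<Sum>i<n. \<Sum>j<n.
      psubst pd1 (\<lambda>c. x i \<otimes> x j \<otimes> c) (lprod (l i) (l j))
    - psubst (\<lambda>t. - (pd1 t + pd2 t)) (\<lambda>c. x i \<otimes> c \<otimes> l j) (lprod (x j) (l i))
    + psubst pd2 (\<lambda>c. c \<otimes> l i \<otimes> l j) (lprod (x i) (x j)))"

definition acybe ::
  "('a::dmod \<Rightarrow> 'a \<Rightarrow> 'a poly) \<Rightarrow> nat \<Rightarrow> (nat \<Rightarrow> 'a) \<Rightarrow> (nat \<Rightarrow> 'a) \<Rightarrow> bool"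
  where "acybe lprod n x l \<longleftrightarrow> bullet lprod n x l \<in> range (\<lambda>t. pd1 t + pd2 t + pd3 t)"

end

theory Submission
  imports Defs
begin

text \<open>
  For \<open>f, g \<in> A\<^bsup>*c\<^esup>\<close> the pairing \<open>a \<otimes> b \<otimes> c \<mapsto> f\<^sub>\<lambda>(a) g\<^bsub>-\<lambda>-\<partial>\<^esub>(b) c\<close> maps \<open>A \<otimes> A \<otimes> A\<close> to \<open>A[\<lambda>]\<close>.
  It sends the three terms of \<open>r \<bullet> r\<close> to the three terms of the identity for \<open>T\<^sup>r\<^sub>0\<close>; the first two agree
  for every \<open>r\<close>, and antisymmetry produces the third one with its sign. The pairing vanishes on the image
  of \<open>\<partial>\<^bsup>\<otimes>3\<^esup>\<close>. Conversely, modulo this image a tensor equals a sum of terms \<open>\<partial>\<^sup>k b \<otimes> b' \<otimes> c\<close>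
  with \<open>b, b'\<close> in a \<open>\<complex>[\<partial>]\<close>-basis of \<open>A\<close>, and the elements \<open>c\<close> are the coefficients of its pairings
  with the dual basis.
\<close>


section \<open>Substituting operators into polynomials\<close>

text \<open>This is \<open>p(\<phi>) v\<close> for a scalar polynomial \<open>p\<close>. With
  \<open>p = cap f a\<close> and \<open>\<phi> = neg_lam_pd\<close> it evaluates f on a at
  -\<lambda>-\<partial> and applies the result to v; with \<open>\<phi> = pd\<close> it is
  \<open>dscale\<close>.\<close>

definition op_subst :: "('b \<Rightarrow> 'b) \<Rightarrow> complex poly \<Rightarrow> 'b \<Rightarrow> 'b::complex_space"
  where "op_subst \<phi> p v = psubst \<phi> (\<lambda>c. c *\<^sub>C v) p"

text \<open>Most later computations are instances: once it is known what \<lambda> or \<partial>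
  becomes under a linear map, the point at which a functional ends up evaluated follows.\<close>

lemma op_subst_comm:
  assumes "clinear \<psi>" "\<And>x. \<psi> (\<phi> x) = \<phi>' (\<psi> x)"
  shows "\<psi> (op_subst \<phi> p v) = op_subst \<phi>' p (\<psi> v)"
  unfolding op_subst_def
  by (subst psubst_comm[of \<psi> \<phi> \<phi>', OF assms]) (simp add: clinear_scale[OF assms(1)])

lemma clinear_scale_left: "clinear (\<lambda>c::complex. c *\<^sub>C v)"
  by (rule clinearI) (simp_all add: scaleC_add_left scaleC_complex_def scaleC_scaleC)

lemma clinear_op_subst_poly:
  assumes "clinear \<phi>"
  shows "clinear (\<lambda>p. op_subst \<phi> p v)"
  unfolding op_subst_def by (rule clinear_psubst[OF assms clinear_scale_left])

lemma clinear_op_subst: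
  assumes "clinear \<phi>"
  shows "clinear (op_subst \<phi> p)"
  by (rule clinearI)
    (simp_all add: op_subst_def scaleC_add_right psubst_fun_add[OF assms]
      psubst_fun_scale[OF assms, symmetric] scaleC_scaleC mult.commute)

lemma op_subst_pCons_0:
  assumes "clinear \<phi>"
  shows "op_subst \<phi> (pCons 0 p) v = \<phi> (op_subst \<phi> p v)"
  unfolding op_subst_def by (simp add: psubst_pCons[OF assms])

lemma psubst_const:
  assumes "clinear \<phi>" "e 0 = 0"
  shows "psubst \<phi> e [:c:] = e c"
  using assms by (simp add: psubst_pCons clinear_0) (simp add: psubst_def clinear_0)

lemma psubst_pCons_0:
  assumes "clinear \<phi>" "clinear e"
  shows "psubst \<phi> e (pCons 0 p) = \<phi> (psubst \<phi> e p)"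
  using assms by (simp add: psubst_pCons clinear_0)

lemma psubst_pd:
  assumes "clinear \<phi>" "clinear e" "clinear \<psi>" 
    "\<And>c. e (pd c) = \<psi> (e c)" "\<And>x. \<psi> (\<phi> x) = \<phi> (\<psi> x)"
  shows "psubst \<phi> e (pd p) = \<psi> (psubst \<phi> e p)"
  unfolding pd_poly_def
  by (simp add: psubst_map_poly assms clinear_0[OF clinear_pd] clinear_0[OF assms(2)]
      psubst_comm[of \<psi> \<phi> \<phi>, OF assms(3,5)])

lemma pd_pCons: "pd (pCons c p) = pCons (pd c) (pd p)"
  by (simp add: poly_eq_iff coeff_pCons split: nat.splits)

lemma pd_pCons_0: "pd (pCons 0 p) = pCons 0 (pd p)"
  by (simp add: pd_pCons clinear_0[OF clinear_pd])

lemma neg_lam_pd_pCons: "neg_lam_pd (pCons 0 q) = pCons 0 (neg_lam_pd q)"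
  by (simp add: neg_lam_pd_def pd_pCons_0)

lemma neg_lam_pd_pd: "neg_lam_pd (pd q) = pd (neg_lam_pd q)"
  by (simp add: neg_lam_pd_def pd_pCons_0 clinear_diff[OF clinear_pd] clinear_minus[OF clinear_pd])

lemma psubst_pCons_const: "psubst (pCons 0) (\<lambda>c. [:c:]) p = (p :: 'a::complex_space poly)"
proof (induction p)
  case 0
  then show ?case by (simp add: psubst_def)
next
  case (pCons a p)
  then show ?case by (simp add: psubst_pCons clinear_pCons)
qed

lemma flip_pCons: "flip (pCons 0 q) = neg_lam_pd (flip q)"
  unfolding flip_def by (simp add: psubst_pCons_0 clinear_neg_lam_pd clinear_const_poly)

lemma flip_pd: "flip (pd q) = pd (flip q)"
  unfolding flip_def
  by (rule psubst_pd)
    (simp_all add: clinear_neg_lam_pd clinear_const_poly clinear_pd pd_pCons neg_lam_pd_pd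
      clinear_0[OF clinear_pd])

text \<open>Substituting -\<lambda>-\<partial> for \<lambda> is an involution:
  -(-\<lambda>-\<partial>)-\<partial> = \<lambda>.\<close>

lemma flip_neg_lam_pd: "flip (neg_lam_pd q) = pCons 0 (flip q)"
proof -
  have "flip (neg_lam_pd q) = - neg_lam_pd (flip q) - pd (flip q)"
    unfolding neg_lam_pd_def[of q] clinear_diff[OF clinear_flip] clinear_minus[OF clinear_flip]
      flip_pCons flip_pd ..
  then show ?thesis
    by (simp add: neg_lam_pd_def)
qed

lemma flip_const: "flip [:c:] = [:c:]"
  unfolding flip_def by (simp add: psubst_const clinear_neg_lam_pd)


section \<open>The conformal dual and the operator \<open>T\<^sup>r\<close>\<close>

lemma cap_pd_cdual: "cap (f :: 'a::dmod cdual) (pd u) = pCons 0 (cap f u)"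
proof -
  have "pd q = 0" for q :: "complex poly"
    by (simp add: poly_eq_iff pd_complex_def)
  then show ?thesis by (simp add: cap_pd)
qed

lemma clinear_op_subst_cap:
  assumes "clinear \<phi>"
  shows "clinear (\<lambda>c. op_subst \<phi> (cap f c) v)"
  by (rule clinear_compose[OF clinear_op_subst_poly[OF assms] clinear_cap])

lemma op_subst_cap_pd:
  fixes f :: "'a::dmod cdual"
  assumes "clinear \<phi>"
  shows "op_subst \<phi> (cap f (pd c)) v = \<phi> (op_subst \<phi> (cap f c) v)"
  by (simp add: cap_pd_cdual op_subst_pCons_0[OF assms])

lemma clinear_neg_pd: "clinear (\<lambda>v. - pd v)"
  by (intro clinear_intros)

text \<open>At \<lambda> = 0 the operator -\<lambda>-\<partial> reduces to -\<partial>: taking the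
  constant coefficient intertwines the two.\<close>

lemma T0_eq: "T0 n x l f = (\<Sum>i<n. op_subst (\<lambda>v. - pd v) (cap f (x i)) (l i))"
proof -
  have "coeff (psubst neg_lam_pd (\<lambda>c. [:c *\<^sub>C l i:]) q) 0 = op_subst (\<lambda>v. - pd v) q (l i)" for i q
    unfolding op_subst_def
    by (subst psubst_comm[where \<psi> = "\<lambda>p. coeff p 0" and \<phi>' = "\<lambda>v. - pd v"])
      (simp_all add: clinear_coeff neg_lam_pd_def)
  then show ?thesis
    by (simp add: T0_def T_op.rep_eq coeff_sum)
qed

lemma clinear_T0: "clinear (T0 n x l)"
  unfolding T0_def by (rule clinear_compose[OF clinear_coeff clinear_cap])

lemma T0_pd: "T0 n x l (pd f) = pd (T0 n x l f)"
  by (simp add: T0_def cap_pd)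

lemma map_poly_T0_flip: "map_poly (T0 n x l) (flip p) = flip (map_poly (T0 n x l) p)"
proof -
  let ?M = "map_poly (T0 n x l)"
  have lin: "clinear ?M"
    by (intro clinear_map_poly clinear_T0)
  have "?M (neg_lam_pd q) = neg_lam_pd (?M q)" for q
    by (simp add: neg_lam_pd_def clinear_diff[OF lin] clinear_minus[OF lin])
      (simp add: poly_eq_iff coeff_map_poly coeff_pCons clinear_0[OF clinear_T0]
        clinear_minus[OF clinear_T0] T0_pd split: nat.splits)
  then have "?M (flip p) = psubst neg_lam_pd (\<lambda>c. ?M [:c:]) p"
    unfolding flip_def by (rule psubst_comm[of ?M neg_lam_pd neg_lam_pd, OF lin])
  also have "\<dots> = flip (?M p)"
    unfolding flip_def
    by (subst psubst_map_poly)
      (simp_all add: clinear_neg_lam_pd clinear_0[OF clinear_T0] map_poly_pCons)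
  finally show ?thesis .
qed

text \<open>By \<open>T0_eq\<close>, \<open>T0\<close> evaluates
  f_{\<mu>-\<lambda>}(\<phi>_\<lambda> x_j) at \<mu> = -\<partial>, which leaves
  f_{-\<lambda>-\<partial>}(\<phi>_\<lambda> x_j) l_j. Finite generation enters through
  \<open>cap_dual_act\<close>, which identifies the coefficients of \<open>dual_act\<close>.\<close>

lemma map_poly_T0_dual_act:
  fixes \<phi> :: "('a::dmod, 'a) Chom"
  assumes fin: "finite S" "dm.span S = (UNIV :: 'a set)"
  shows "map_poly (T0 n x l) (dual_act \<phi> f) =
    (\<Sum>j<n. psubst (pCons 0) (\<lambda>c. op_subst neg_lam_pd (cap f c) [:l j:]) (cap \<phi> (x j)))"
proof -
  \<comment> \<open>\<open>M j\<close> substitutes -\<partial> for \<mu> and applies the result to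
    \<open>l j\<close>; hence \<mu>-\<lambda> becomes -\<lambda>-\<partial>, as \<open>op\<close>
    records.\<close>
  define M where "M j = map_poly (\<lambda>p. op_subst (\<lambda>v. - pd v) p (l j))" for j
  have lin: "clinear (\<lambda>p. op_subst (\<lambda>v. - pd v) p (l j))" for j
    by (rule clinear_op_subst_poly[OF clinear_neg_pd])
  have linM: "clinear (M j)" for j
    unfolding M_def by (rule clinear_map_poly[OF lin])
  have Mlam: "M j (mul_lam X) = pCons 0 (M j X)" for j X
    by (simp add: M_def map_poly_pCons clinear_0[OF lin])
  have Mmu: "M j (mul_mu X) = - pd (M j X)" for j X
    by (simp add: M_def poly_eq_iff coeff_map_poly clinear_0[OF lin] op_subst_pCons_0[OF clinear_neg_pd])
  have op: "M j (mul_mu X - mul_lam X) = neg_lam_pd (M j X)" for j X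
    by (simp add: clinear_diff[OF linM] Mlam Mmu neg_lam_pd_def)
  have Mc: "M j [:[:z:]:] = z *\<^sub>C [:l j:]" for j z
  proof -
    have "op_subst (\<lambda>v. - pd v) [:z:] (l j) = z *\<^sub>C l j"
      by (simp add: op_subst_def psubst_const clinear_neg_pd)
    then have "M j [:[:z:]:] = [:z *\<^sub>C l j:]"
      by (simp add: M_def map_poly_pCons clinear_0[OF lin])
    then show ?thesis
      by (simp add: poly_eq_iff coeff_pCons split: nat.splits)
  qed
  have "map_poly (T0 n x l) (dual_act \<phi> f) = (\<Sum>j<n. M j (dual_val \<phi> f (x j)))"
    by (rule poly_eqI, subst coeff_map_poly)
      (simp_all add: clinear_0[OF clinear_T0] coeff_sum M_def coeff_map_poly clinear_0[OF lin],
        simp add: T0_eq cap_dual_act[OF fin])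
  moreover have "M j (dual_val \<phi> f (x j)) =
      psubst (pCons 0) (\<lambda>c. op_subst neg_lam_pd (cap f c) [:l j:]) (cap \<phi> (x j))" for j
    unfolding dual_val_def psubst_comm[of "M j" mul_lam "pCons 0", OF linM Mlam]
      psubst_comm[of "M j" "\<lambda>X. mul_mu X - mul_lam X" neg_lam_pd, OF linM op] Mc op_subst_def ..
  ultimately show ?thesis
    by simp
qed

section \<open>The terms of the identity for \<open>T0\<close> as double sums\<close>

context assoc_conformal_algebra
begin

lemma clinear_lprod_left: "clinear (\<lambda>a. lprod a b)"
  and clinear_lprod_right: "clinear (lprod a)"
  using lprod_bilinear by (simp_all add: cbilinear_def)

text \<open>By sesquilinearity -\<partial> in the left factor comes out as \<lambda>; in the right
  factor, below, it comes out as -\<lambda>-\<partial>.\<close>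

lemma lprod_T0_left:
  "lprod (T0 n x l f) b = (\<Sum>i<n. op_subst (pCons 0) (cap f (x i)) (lprod (l i) b))"
  unfolding T0_eq clinear_sum[OF clinear_lprod_left]
  by (subst op_subst_comm[OF clinear_lprod_left, where \<phi>' = "pCons 0"])
    (simp_all add: clinear_minus[OF clinear_lprod_left] lprod_pd_left)

lemma lprod_T0_right:
  "lprod a (T0 n x l f) = (\<Sum>i<n. op_subst neg_lam_pd (cap f (x i)) (lprod a (l i)))"
  unfolding T0_eq clinear_sum[OF clinear_lprod_right]
  by (subst op_subst_comm[OF clinear_lprod_right, where \<phi>' = neg_lam_pd])
    (simp_all add: clinear_minus[OF clinear_lprod_right] lprod_pd_right neg_lam_pd_def)

lemma T0_R_dual_act:
  assumes fin: "finite S" "dm.span S = (UNIV :: 'a set)"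
  shows "map_poly (T0 n x l) (dual_act (R_A lprod (T0 n x l f)) g) =
    (\<Sum>i<n. \<Sum>j<n. op_subst (pCons 0) (cap f (x i))
      (psubst pd (\<lambda>c. op_subst neg_lam_pd (cap g c) [:l j:]) (lprod (x j) (l i))))"
proof -
  define e where "e j c = op_subst neg_lam_pd (cap g c) [:l j:]" for j c
  note e_eq = e_def[abs_def]
  \<comment> \<open>\<open>P\<close> and \<open>Q\<close> both send a coefficient c to
    g_{-\<lambda>-\<partial>}(c) l_j; \<open>P\<close> keeps the variable \<lambda>, while
    \<open>Q\<close> replaces it by \<partial>.\<close>
  define P where "P j = psubst (pCons 0) (e j)" for j
  define Q where "Q j = psubst pd (e j)" for j
  have line: "clinear (e j)" for j
    unfolding e_def by (rule clinear_op_subst_cap[OF clinear_neg_lam_pd])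
  have linP: "clinear (P j)" and linQ: "clinear (Q j)" for j
    unfolding P_def Q_def by (intro clinear_psubst line clinear_pCons clinear_pd)+
  have epd: "e j (pd c) = neg_lam_pd (e j c)" for j c
    unfolding e_def by (rule op_subst_cap_pd[OF clinear_neg_lam_pd])
  have "P j (pd q) = neg_lam_pd (P j q)" for j q
    unfolding P_def
    by (rule psubst_pd) (simp_all add: clinear_pCons line clinear_neg_lam_pd epd neg_lam_pd_pCons)
  moreover have "P j (pCons 0 q) = pCons 0 (P j q)" for j q
    unfolding P_def by (rule psubst_pCons_0[OF clinear_pCons line])
  \<comment> \<open>Under \<open>P\<close>, \<partial> becomes -\<lambda>-\<partial>, so
    -\<lambda>-\<partial> becomes \<partial>. This absorbs the \<open>flip\<close> inside
    \<open>R_A\<close> and turns \<open>P\<close> into \<open>Q\<close>.\<close>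
  ultimately have Pop: "P j (neg_lam_pd q) = pd (P j q)" for j q
    unfolding neg_lam_pd_def[of q] clinear_diff[OF linP] clinear_minus[OF linP]
    by (simp add: neg_lam_pd_def)
  have "P j (flip q) = psubst pd (\<lambda>c. P j [:c:]) q" for j q
    unfolding flip_def by (rule psubst_comm[of "P j" neg_lam_pd pd, OF linP Pop])
  then have Pflip: "P j (flip q) = Q j q" for j q
    by (simp add: P_def Q_def psubst_const clinear_pCons clinear_0[OF line])
  have "Q j (pd q) = neg_lam_pd (Q j q)" for j q
    unfolding Q_def
    by (rule psubst_pd) (simp_all add: clinear_pd line clinear_neg_lam_pd epd neg_lam_pd_pd)
  moreover have "Q j (pCons 0 q) = pd (Q j q)" for j q
    unfolding Q_def by (rule psubst_pCons_0[OF clinear_pd line])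
  \<comment> \<open>Under \<open>Q\<close>, \<lambda> becomes \<partial> and \<partial> becomes
    -\<lambda>-\<partial>, so -\<lambda>-\<partial> becomes \<lambda>: the functional f from
    \<open>lprod_T0_right\<close> is then evaluated at \<lambda>.\<close>
  ultimately have Qop: "Q j (neg_lam_pd q) = pCons 0 (Q j q)" for j q
    unfolding neg_lam_pd_def[of q] clinear_diff[OF linQ] clinear_minus[OF linQ]
    by (simp add: neg_lam_pd_def)
  have "map_poly (T0 n x l) (dual_act (R_A lprod (T0 n x l f)) g) =
      (\<Sum>j<n. Q j (lprod (x j) (T0 n x l f)))"
    by (simp add: map_poly_T0_dual_act[OF fin] cap_R_A Pflip[symmetric]) (simp add: P_def e_eq)
  also have "\<dots> = (\<Sum>j<n. \<Sum>i<n. op_subst (pCons 0) (cap f (x i)) (Q j (lprod (x j) (l i))))"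
    by (simp add: lprod_T0_right clinear_sum[OF linQ] op_subst_comm[of "Q _" neg_lam_pd "pCons 0", OF linQ Qop])
  also have "\<dots> = (\<Sum>i<n. \<Sum>j<n. op_subst (pCons 0) (cap f (x i)) (Q j (lprod (x j) (l i))))"
    by (rule sum.swap)
  finally show ?thesis
    by (simp add: Q_def e_eq)
qed

text \<open>The outer \<open>flip\<close> exchanges \<lambda> and -\<lambda>-\<partial>. So f is
  evaluated at \<lambda>, and g, coming from \<open>lprod_T0_left\<close>, at -\<lambda>-\<partial>,
  as in \<open>pairing\<close>.\<close>

lemma T0_L_dual_act:
  assumes fin: "finite S" "dm.span S = (UNIV :: 'a set)"
  shows "map_poly (T0 n x l) (flip (dual_act (L_A lprod (T0 n x l g)) f)) =
    (\<Sum>i<n. \<Sum>j<n. op_subst neg_lam_pd (cap g (x i))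
      (psubst neg_lam_pd (\<lambda>c. op_subst (pCons 0) (cap f c) [:l j:]) (lprod (l i) (x j))))"
proof -
  define e where "e j c = op_subst (pCons 0) (cap f c) [:l j:]" for j c
  note e_eq = e_def[abs_def]
  define P where "P j = psubst neg_lam_pd (e j)" for j
  have line: "clinear (e j)" for j
    unfolding e_def by (rule clinear_op_subst_cap[OF clinear_pCons])
  have linP: "clinear (P j)" for j
    unfolding P_def by (intro clinear_psubst line clinear_neg_lam_pd)
  have Plam: "P j (pCons 0 q) = neg_lam_pd (P j q)" for j q
    unfolding P_def by (rule psubst_pCons_0[OF clinear_neg_lam_pd line])
  have "flip (op_subst neg_lam_pd (cap f c) [:l j:]) = e j c" for j c
    by (simp add: op_subst_comm[of flip neg_lam_pd "pCons 0", OF clinear_flip flip_neg_lam_pd] flip_const e_def)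
  then have "flip (psubst (pCons 0) (\<lambda>c. op_subst neg_lam_pd (cap f c) [:l j:]) q) = P j q" for j q
    by (simp add: psubst_comm[of flip "pCons 0" neg_lam_pd, OF clinear_flip flip_pCons] P_def)
  then have "map_poly (T0 n x l) (flip (dual_act (L_A lprod (T0 n x l g)) f)) =
      (\<Sum>j<n. P j (lprod (T0 n x l g) (x j)))"
    by (simp add: map_poly_T0_flip map_poly_T0_dual_act[OF fin] cap_L_A clinear_sum[OF clinear_flip])
  also have "\<dots> = (\<Sum>j<n. \<Sum>i<n. op_subst neg_lam_pd (cap g (x i)) (P j (lprod (l i) (x j))))"
    by (simp add: lprod_T0_left clinear_sum[OF linP] op_subst_comm[of "P _" "pCons 0" neg_lam_pd, OF linP Plam])
  also have "\<dots> = (\<Sum>i<n. \<Sum>j<n. op_subst neg_lam_pd (cap g (x i)) (P j (lprod (l i) (x j))))"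
    by (rule sum.swap)
  finally show ?thesis
    by (simp add: P_def e_eq)
qed

end


section \<open>Pairing \<open>A \<otimes> A \<otimes> A\<close> with two functionals\<close>

lemma clinear_tens_left: "clinear (\<lambda>a. a \<otimes> b)"
  and clinear_tens_right: "clinear (\<lambda>b. a \<otimes> b)"
  using cbilinear_tens unfolding cbilinear_def by blast+

text \<open>Scalars are absorbed into the left factor, so sums of pure tensors exhaust the
  space.\<close>

lemma tensor_induct [case_names zero tens add]:
  assumes "P 0" "\<And>a b. P (a \<otimes> b)" "\<And>s t. P s \<Longrightarrow> P t \<Longrightarrow> P (s + t)"
  shows "P (t :: ('a::complex_space, 'b::complex_space) tensor)"
proof -
  obtain p where "t = abs_tensor p"
    by (metis Quotient_abs_rep[OF Quotient_tensor])
  moreover have "P (abs_tensor p)"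
  proof (induction p rule: Poly_Mapping.update_induct)
    case const
    then show ?case using assms(1) by (simp add: zero_tensor.abs_eq)
  next
    case (update p k v)
    have "Poly_Mapping.update k v p = Poly_Mapping.single k v + p"
      using update(1) by (auto simp: poly_mapping_eq_iff fun_eq_iff lookup_update
          Poly_Mapping.lookup_add Poly_Mapping.lookup_single when_def in_keys_iff)
    moreover have "abs_tensor (Poly_Mapping.single k v) = (v *\<^sub>C fst k) \<otimes> snd k"
      unfolding clinear_scale[OF clinear_tens_left]
      unfolding tens.abs_eq scaleC_tensor.abs_eq
      by (rule arg_cong[of _ _ abs_tensor])
        (simp add: poly_mapping_eq_iff fun_eq_iff Poly_Mapping.lookup_single when_def)
    ultimately show ?case
      using update(3) assms(2,3) by (simp add: plus_tensor.abs_eq[symmetric])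
  qed
  ultimately show ?thesis by simp
qed

lemma clinear_eq_tens3I:
  assumes "clinear F" "clinear G" "\<And>a b c. F (a \<otimes> b \<otimes> c) = G (a \<otimes> b \<otimes> c)"
  shows "F t = G t"
proof (induction t rule: tensor_induct)
  case (tens a u)
  show ?case
    by (induction u rule: tensor_induct)
      (simp_all add: clinear_0[OF clinear_tens_right] clinear_add[OF clinear_tens_right]
        clinear_0[OF assms(1)] clinear_0[OF assms(2)] clinear_add[OF assms(1)] clinear_add[OF assms(2)]
        assms(3))
qed (simp_all add: clinear_0[OF assms(1)] clinear_0[OF assms(2)] clinear_add[OF assms(1)]
    clinear_add[OF assms(2)])

lemma clinear_tensor_map:
  assumes "clinear g" "clinear h"
  shows "clinear (tensor_map g h)"
  unfolding tensor_map_def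
  by (intro clinear_tensor_lift)
    (auto simp: cbilinear_def intro: clinear_compose[OF clinear_tens_left assms(1)]
      clinear_compose[OF clinear_tens_right assms(2)])

lemma clinear_pd1: "clinear pd1" and clinear_pd2: "clinear pd2" and clinear_pd3: "clinear pd3"
  unfolding pd1_def pd2_def pd3_def by (intro clinear_tensor_map clinear_ident clinear_pd)+

lemma pd1_pd2: "pd1 (pd2 t) = pd2 (pd1 t)"
  by (rule clinear_eq_tens3I[OF clinear_compose[OF clinear_pd1 clinear_pd2]
        clinear_compose[OF clinear_pd2 clinear_pd1]]) (simp add: pd123_tens)

lemma pd1_pd3: "pd1 (pd3 t) = pd3 (pd1 t)"
  by (rule clinear_eq_tens3I[OF clinear_compose[OF clinear_pd1 clinear_pd3]
        clinear_compose[OF clinear_pd3 clinear_pd1]]) (simp add: pd123_tens)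

lemma pd2_pd3: "pd2 (pd3 t) = pd3 (pd2 t)"
  by (rule clinear_eq_tens3I[OF clinear_compose[OF clinear_pd2 clinear_pd3]
        clinear_compose[OF clinear_pd3 clinear_pd2]]) (simp add: pd123_tens)

definition pairing :: "'a::dmod cdual \<Rightarrow> 'a cdual \<Rightarrow> 'a tensor3 \<Rightarrow> 'a poly"
  where "pairing f g = tensor_lift (\<lambda>a. tensor_lift (\<lambda>b c.
    op_subst (pCons 0) (cap f a) (op_subst neg_lam_pd (cap g b) [:c:])))"

lemma
  fixes f g :: "'a::dmod cdual"
  shows pairing_tens: "pairing f g (a \<otimes> b \<otimes> c) =
      op_subst (pCons 0) (cap f a) (op_subst neg_lam_pd (cap g b) [:c:])"
    and clinear_pairing: "clinear (pairing f g)"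
proof -
  define h where "h a b c = op_subst (pCons 0) (cap f a) (op_subst neg_lam_pd (cap g b) [:c:])"
    for a b c :: 'a
  have lin: "clinear (\<lambda>a. op_subst (pCons 0) (cap f a) v)" for v :: "'a poly"
    by (rule clinear_op_subst_cap[OF clinear_pCons])
  have hadd: "h (a + a') b c = h a b c + h a' b c" and hscale: "h (k *\<^sub>C a) b c = k *\<^sub>C h a b c"
    for a a' b c k
    unfolding h_def by (simp_all only: clinear_add[OF lin] clinear_scale[OF lin])
  have bil: "cbilinear (h a)" for a
    unfolding cbilinear_def h_def
    by (intro conjI allI clinear_compose[OF clinear_op_subst[OF clinear_pCons]]
        clinear_compose[OF clinear_op_subst[OF clinear_neg_lam_pd] clinear_const_poly]
        clinear_op_subst_cap[OF clinear_neg_lam_pd])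
  \<comment> \<open>Here a varies inside the map being lifted, so linearity in a is checked on pure
    tensors u.\<close>
  have "tensor_lift (h (a + a')) u = tensor_lift (h a) u + tensor_lift (h a') u" for a a' u
    by (induction u rule: tensor_induct,
        simp_all add: clinear_0[OF clinear_tensor_lift[OF bil]] clinear_add[OF clinear_tensor_lift[OF bil]]
        tensor_lift_tens[OF bil] ac_simps)
      (simp_all add: hadd)
  moreover have "tensor_lift (h (k *\<^sub>C a)) u = k *\<^sub>C tensor_lift (h a) u" for a k u
    by (induction u rule: tensor_induct,
        simp_all add: clinear_0[OF clinear_tensor_lift[OF bil]] clinear_add[OF clinear_tensor_lift[OF bil]]
        tensor_lift_tens[OF bil] scaleC_add_right)
      (simp_all add: hscale)
  ultimately have bil2: "cbilinear (\<lambda>a. tensor_lift (h a))"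
    unfolding cbilinear_def by (auto intro: clinear_tensor_lift[OF bil] clinearI)
  have eq: "pairing f g = tensor_lift (\<lambda>a. tensor_lift (h a))"
    unfolding pairing_def h_def ..
  show "pairing f g (a \<otimes> b \<otimes> c) =
      op_subst (pCons 0) (cap f a) (op_subst neg_lam_pd (cap g b) [:c:])"
    by (simp add: eq tensor_lift_tens[OF bil2] tensor_lift_tens[OF bil]) (simp add: h_def)
  show "clinear (pairing f g)"
    unfolding eq by (rule clinear_tensor_lift[OF bil2])
qed

lemma neg_lam_pd_op_subst:
  "neg_lam_pd (op_subst (pCons 0) p q) = op_subst (pCons 0) p (neg_lam_pd q)"
  by (rule op_subst_comm[of neg_lam_pd "pCons 0" "pCons 0", OF clinear_neg_lam_pd neg_lam_pd_pCons])

lemma pd_op_subst_pCons: "pd (op_subst (pCons 0) p q) = op_subst (pCons 0) p (pd q)"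
  by (rule op_subst_comm[of pd "pCons 0" "pCons 0", OF clinear_pd pd_pCons_0])

lemma pd_op_subst_neg_lam_pd: "pd (op_subst neg_lam_pd p q) = op_subst neg_lam_pd p (pd q)"
  by (rule op_subst_comm[of pd neg_lam_pd neg_lam_pd, OF clinear_pd neg_lam_pd_pd[symmetric]])

lemma pairing_pd1: "pairing f g (pd1 t) = pCons 0 (pairing f g t)"
  by (rule clinear_eq_tens3I[OF clinear_compose[OF clinear_pairing clinear_pd1]
        clinear_compose[OF clinear_pCons clinear_pairing]])
    (simp add: pd123_tens pairing_tens op_subst_cap_pd clinear_pCons)

lemma pairing_pd2: "pairing f g (pd2 t) = neg_lam_pd (pairing f g t)"
  by (rule clinear_eq_tens3I[OF clinear_compose[OF clinear_pairing clinear_pd2]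
        clinear_compose[OF clinear_neg_lam_pd clinear_pairing]])
    (simp add: pd123_tens pairing_tens op_subst_cap_pd clinear_neg_lam_pd neg_lam_pd_op_subst)

lemma pairing_pd3: "pairing f g (pd3 t) = pd (pairing f g t)"
  by (rule clinear_eq_tens3I[OF clinear_compose[OF clinear_pairing clinear_pd3]
        clinear_compose[OF clinear_pd clinear_pairing]])
    (simp add: pd123_tens pairing_tens pd_op_subst_pCons pd_op_subst_neg_lam_pd pd_pCons
      clinear_0[OF clinear_pd])

text \<open>The three copies of \<partial> become \<lambda>, -\<lambda>-\<partial> and \<partial>,
  whose sum is zero; this is why \<open>pairing\<close> evaluates g at
  -\<lambda>-\<partial>.\<close>

lemma pairing_pd_total: "pairing f g (pd1 t + pd2 t + pd3 t) = 0"
  by (simp add: clinear_add[OF clinear_pairing] pairing_pd1 pairing_pd2 pairing_pd3)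
    (simp add: neg_lam_pd_def)

section \<open>The pairings of r \<bullet> r\<close>

context assoc_conformal_algebra
begin

lemma pairing_bullet:
  assumes fin: "finite S" "dm.span S = (UNIV :: 'a set)"
    and anti: "tensor_swap (\<Sum>i<n. x i \<otimes> l i) = - (\<Sum>i<n. x i \<otimes> l i)"
  shows "pairing f g (bullet lprod n x l) =
    lprod (T0 n x l f) (T0 n x l g)
      - map_poly (T0 n x l) (dual_act (R_A lprod (T0 n x l f)) g)
      - map_poly (T0 n x l) (flip (dual_act (L_A lprod (T0 n x l g)) f))"
proof -
  \<comment> \<open>\<open>\<beta> j (x i) (l i)\<close> is the third term of r \<bullet> r after
    pairing, and \<open>\<beta> j (l i) (x i)\<close> is the summand in
    \<open>T0_L_dual_act\<close>: the two differ by a swap of the factors of r.\<close>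
  define \<beta> where "\<beta> j u v = op_subst neg_lam_pd (cap g v)
      (psubst neg_lam_pd (\<lambda>c. op_subst (pCons 0) (cap f c) [:l j:]) (lprod u (x j)))" for j u v
  have "pairing f g (psubst pd1 (\<lambda>c. x i \<otimes> x j \<otimes> c) p) =
      op_subst (pCons 0) (cap f (x i)) (op_subst neg_lam_pd (cap g (x j)) p)" for i j p
  proof -
    \<comment> \<open>\<open>pd1\<close> becomes \<lambda> and \<open>\<psi>\<close> commutes with
      \<lambda>, so the substitution reassembles the polynomial \<open>p\<close> inside
      \<open>\<psi>\<close>.\<close>
    define \<psi> where "\<psi> q = op_subst (pCons 0) (cap f (x i)) (op_subst neg_lam_pd (cap g (x j)) q)"
      for q :: "'a poly"
    have lin: "clinear \<psi>"
      unfolding \<psi>_def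
      by (intro clinear_compose[OF clinear_op_subst] clinear_op_subst clinear_pCons clinear_neg_lam_pd)
    have comm: "\<psi> (pCons 0 q) = pCons 0 (\<psi> q)" for q
      unfolding \<psi>_def
      by (simp add: op_subst_comm[of "pCons 0" "pCons 0" "pCons 0", OF clinear_pCons refl]
          op_subst_comm[of "pCons 0" neg_lam_pd neg_lam_pd, OF clinear_pCons neg_lam_pd_pCons[symmetric]])
    show ?thesis
      unfolding psubst_comm[of "pairing f g" pd1 "pCons 0", OF clinear_pairing pairing_pd1] pairing_tens
      using psubst_comm[of \<psi> "pCons 0" "pCons 0" "\<lambda>c. [:c:]" p, OF lin comm] by (simp add: psubst_pCons_const \<psi>_def)
  qed
  note 1 = this
  \<comment> \<open>The sign works out as -\<lambda>-(-\<lambda>-\<partial>) = \<partial>, matching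
    the \<open>psubst pd\<close> in \<open>T0_R_dual_act\<close>.\<close>
  have tot: "pairing f g (- (pd1 t + pd2 t)) = pd (pairing f g t)" for t
    by (simp add: clinear_add[OF clinear_pairing] clinear_diff[OF clinear_pairing]
        clinear_minus[OF clinear_pairing] pairing_pd1 pairing_pd2) (simp add: neg_lam_pd_def)
  have 2: "pairing f g (psubst (\<lambda>t. - (pd1 t + pd2 t)) (\<lambda>c. x i \<otimes> c \<otimes> l j) p) =
      op_subst (pCons 0) (cap f (x i)) (psubst pd (\<lambda>c. op_subst neg_lam_pd (cap g c) [:l j:]) p)" for i j p
    unfolding psubst_comm[of "pairing f g" "\<lambda>t. - (pd1 t + pd2 t)" pd, OF clinear_pairing tot] pairing_tens
    by (rule psubst_comm[symmetric]) (simp_all add: clinear_op_subst clinear_pCons pd_op_subst_pCons)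
  have comm: "op_subst (pCons 0) p (op_subst neg_lam_pd q c) =
      op_subst neg_lam_pd q (op_subst (pCons 0) p c)" for p q and c :: "'a poly"
    by (rule op_subst_comm[of "op_subst (pCons 0) p" neg_lam_pd neg_lam_pd,
          OF clinear_op_subst[OF clinear_pCons] neg_lam_pd_op_subst[symmetric]])
  have 3: "pairing f g (psubst pd2 (\<lambda>c. c \<otimes> l i \<otimes> l j) (lprod (x i) (x j))) = \<beta> j (x i) (l i)" for i j
    unfolding psubst_comm[of "pairing f g" pd2 neg_lam_pd, OF clinear_pairing pairing_pd2] pairing_tens \<beta>_def comm
    by (rule psubst_comm[symmetric]; (intro clinear_op_subst clinear_neg_lam_pd)?)
      (rule op_subst_comm[of neg_lam_pd neg_lam_pd neg_lam_pd, OF clinear_neg_lam_pd refl, symmetric])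
  have bil: "cbilinear (\<beta> j)" for j
    unfolding cbilinear_def \<beta>_def
    by (intro conjI allI clinear_op_subst_cap clinear_neg_lam_pd
        clinear_compose[OF clinear_op_subst[OF clinear_neg_lam_pd]]
        clinear_compose[OF clinear_psubst clinear_lprod_left] clinear_op_subst_cap clinear_pCons)
  \<comment> \<open>Being bilinear, \<open>\<beta> j\<close> factors through the tensor product, so
    antisymmetry of r applies to the sum over i with j fixed.\<close>
  have \<beta>: "(\<Sum>i<n. \<beta> j (x i) (l i)) = - (\<Sum>i<n. \<beta> j (l i) (x i))" for j
  proof -
    have lin: "clinear (tensor_swap :: ('a, 'a) tensor \<Rightarrow> _)"
      unfolding tensor_swap_def
      by (rule clinear_tensor_lift) (simp add: cbilinear_def clinear_tens_left clinear_tens_right)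
    have "tensor_lift (\<beta> j) (\<Sum>i<n. l i \<otimes> x i) = - tensor_lift (\<beta> j) (\<Sum>i<n. x i \<otimes> l i)"
      using anti
      by (simp add: clinear_sum[OF lin] tensor_swap_tens clinear_minus[OF clinear_tensor_lift[OF bil]])
    then show ?thesis
      by (simp add: clinear_sum[OF clinear_tensor_lift[OF bil]] tensor_lift_tens[OF bil])
  qed
  have "pairing f g (bullet lprod n x l) = 
      (\<Sum>i<n. \<Sum>j<n. op_subst (pCons 0) (cap f (x i))
        (op_subst neg_lam_pd (cap g (x j)) (lprod (l i) (l j))))
    - (\<Sum>i<n. \<Sum>j<n. op_subst (pCons 0) (cap f (x i))
      (psubst pd (\<lambda>c. op_subst neg_lam_pd (cap g c) [:l j:]) (lprod (x j) (l i))))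
    + (\<Sum>i<n. \<Sum>j<n. \<beta> j (x i) (l i))"
    by (simp only: bullet_def clinear_sum[OF clinear_pairing] clinear_add[OF clinear_pairing]
        clinear_diff[OF clinear_pairing] 1 2 3 sum.distrib sum_subtractf)
  also have "(\<Sum>i<n. \<Sum>j<n. \<beta> j (x i) (l i)) = - (\<Sum>i<n. \<Sum>j<n. \<beta> j (l i) (x i))"
    by (subst (1 2) sum.swap) (simp only: \<beta> sum_negf)
  also have "(\<Sum>i<n. \<Sum>j<n. \<beta> j (l i) (x i)) =
      map_poly (T0 n x l) (flip (dual_act (L_A lprod (T0 n x l g)) f))"
    unfolding T0_L_dual_act[OF fin] \<beta>_def ..
  also have "(\<Sum>i<n. \<Sum>j<n. op_subst (pCons 0) (cap f (x i))
        (op_subst neg_lam_pd (cap g (x j)) (lprod (l i) (l j)))) = lprod (T0 n x l f) (T0 n x l g)"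
    by (simp only: lprod_T0_left)
      (simp only: lprod_T0_right clinear_sum[OF clinear_op_subst[OF clinear_pCons]])
  finally show ?thesis
    by (simp add: T0_R_dual_act[OF fin])
qed

end


section \<open>Separating \<open>A \<otimes> A \<otimes> A\<close> modulo \<open>\<partial>\<close> by functionals\<close>

text \<open>Coordinates with respect to a finite basis are \<complex>[\<partial>]-linear maps to
  polynomials. Reading \<partial> as \<lambda> makes them conformal functionals, since \<partial> =
  0 on \<complex>.\<close>

lemma ex_dual_basis:
  fixes S B :: "'a::dmod set"
  assumes "finite S" "dm.span S = UNIV" "dm.independent B" "dm.span B = UNIV"
  shows "\<exists>C (d :: 'a \<Rightarrow> 'a cdual). finite C \<and> (\<forall>a. (\<Sum>b\<in>C. dscale (cap (d b) a) b) = a)"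
proof -
  have "\<exists>t. finite t \<and> t \<subseteq> B \<and> s \<in> dm.span t" for s
  proof -
    have "s \<in> dm.span B" using assms(4) by simp
    then obtain t q where t: "finite t" "t \<subseteq> B" and s: "s = (\<Sum>a\<in>t. dscale (q a) a)"
      unfolding dm.span_explicit by blast
    have "s \<in> dm.span t"
      unfolding s by (intro dm.span_sum dm.span_scale dm.span_base)
    with t show ?thesis
      by blast
  qed
  then obtain t where t: "finite (t s)" "t s \<subseteq> B" "s \<in> dm.span (t s)" for s
    by metis
  \<comment> \<open>The basis elements that occur in expansions of the finitely many generators;
    they still span, and a subset of B stays independent.\<close>
  define C where "C = (\<Union>s\<in>S. t s)"
  have C: "finite C" "C \<subseteq> B" using t assms(1) by (auto simp: C_def)
  have "S \<subseteq> dm.span C"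
    using t(3) dm.span_mono[of "t _" C] by (auto simp: C_def)
  then have span: "dm.span C = UNIV"
    using assms(2) dm.span_minimal[OF _ dm.subspace_span] by blast
  have ind: "dm.independent C"
    using assms(3) C(2) by (rule dm.independent_mono)
  define D where "D b a = dm.representation C a b" for a b
  have pd: "pd a = dscale [:0, 1:] a" for a :: 'a
    by (simp add: dscale_pCons scaleC_one clinear_0[OF clinear_pd])
  have sc: "k *\<^sub>C a = dscale [:k:] a" for k and a :: 'a
    by (simp add: dscale_pCons clinear_0[OF clinear_pd])
  have "D b (pd a) = pCons 0 (D b a)" for a b
    unfolding D_def pd by (subst dm.representation_scale) (simp_all add: ind span)
  moreover have "clinear (D b)" for b
  proof (rule clinearI)
    show "D b (u + v) = D b u + D b v" for u v
      unfolding D_def by (subst dm.representation_add) (simp_all add: ind span)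
    show "D b (k *\<^sub>C u) = k *\<^sub>C D b u" for k u
      unfolding D_def sc by (subst dm.representation_scale)
        (simp_all add: ind span poly_eq_iff scaleC_complex_def)
  qed
  moreover have "pd q = 0" for q :: "complex poly"
    by (simp add: poly_eq_iff pd_complex_def)
  ultimately have cap: "cap (Chom (D b)) = D b" for b
    by (intro Chom_inverse) simp
  have dual: "(\<Sum>b\<in>C. dscale (cap (Chom (D b)) a) b) = a" for a
    unfolding cap D_def
    by (rule dm.sum_representation_eq[OF ind _ C(1) order_refl]) (simp add: span)
  show ?thesis
    by (intro exI conjI allI) (rule C(1), rule dual)
qed

text \<open>Modulo \<open>range (\<lambda>t. pd1 t + pd2 t + pd3 t)\<close> the operator \<open>-(\<lambda>+\<partial>)\<close> on \<open>A[\<lambda>]\<close> goes to \<open>pd2\<close>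
  under \<open>\<lambda>\<^sup>k c \<mapsto> pd1\<^sup>k (b \<otimes> b' \<otimes> c)\<close>, so these maps for the pairs of a dual basis
  recover a tensor from its pairings.\<close>

lemma in_range_if_pairings_zero:
  fixes d :: "'a::dmod \<Rightarrow> 'a cdual"
  assumes dual: "\<And>a. (\<Sum>b\<in>C. dscale (cap (d b) a) b) = a"
    and zero: "\<And>f g. pairing f g (t :: 'a tensor3) = 0"
  shows "t \<in> range (\<lambda>t. pd1 t + pd2 t + pd3 t)"
proof -
  define W where "W b b' = psubst pd1 (\<lambda>c. b \<otimes> b' \<otimes> c)" for b b' :: 'a
  define R where "R = range (\<lambda>t :: 'a tensor3. pd1 t + pd2 t + pd3 t)"
  define D where "D t = pd1 t + pd2 t + pd3 t" for t :: "'a tensor3"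
  have R: "R = range D" unfolding R_def D_def ..
  have linD: "clinear D"
    unfolding D_def by (intro clinear_add_fun clinear_pd1 clinear_pd2 clinear_pd3)
  have RI: "D u \<in> R" for u
    unfolding R by (rule rangeI)
  have R0: "0 \<in> R"
    using RI[of 0] by (simp add: clinear_0[OF linD])
  have Radd: "u + v \<in> R" if "u \<in> R" "v \<in> R" for u v
    using that unfolding R by (auto simp: clinear_add[OF linD, symmetric])
  have Rscale: "k *\<^sub>C u \<in> R" if "u \<in> R" for u k
    using that unfolding R by (auto simp: clinear_scale[OF linD, symmetric])
  have Rsum: "sum h A \<in> R" if "\<And>a. a \<in> A \<Longrightarrow> h a \<in> R" for h and A :: "'a set"
    using that by (induction A rule: infinite_finite_induct) (auto intro: R0 Radd)
  have Rpd: "pd2 u \<in> R" if "u \<in> R" for u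
  proof -
    have "pd2 (D v) = D (pd2 v)" for v
      by (simp add: D_def clinear_add[OF clinear_pd2] pd1_pd2 pd2_pd3)
    then show ?thesis using that unfolding R by auto
  qed
  have line: "clinear (\<lambda>c. b \<otimes> b' \<otimes> c)" for b b' :: 'a
    by (intro clinear_compose[OF clinear_tens_right] clinear_tens_right)
  have linW: "clinear (W b b')" for b b'
    unfolding W_def by (intro clinear_psubst clinear_pd1 line)
  have Wlam: "W b b' (pCons 0 q) = pd1 (W b b' q)" for b b' q
    unfolding W_def by (rule psubst_pCons_0[OF clinear_pd1 line])
  have Wpd: "W b b' (pd q) = pd3 (W b b' q)" for b b' q
    unfolding W_def
    by (rule psubst_pd) (simp_all add: clinear_pd1 clinear_pd3 line pd123_tens pd1_pd3)
  have Wop: "W b b' (neg_lam_pd q) = pd2 (W b b' q) - D (W b b' q)" for b b' q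
    by (simp add: neg_lam_pd_def clinear_diff[OF linW] clinear_minus[OF linW]
        clinear_minus[OF clinear_pd1] clinear_minus[OF clinear_pd3] Wlam Wpd D_def)
  \<comment> \<open>Replacing -\<lambda>-\<partial> by \<open>pd2\<close> costs one element of
    \<open>R\<close> per degree, and earlier errors stay in \<open>R\<close> because
    \<open>pd2\<close> commutes with \<open>D\<close>.\<close>
  have Wsub: "W b b' (op_subst neg_lam_pd p q) - op_subst pd2 p (W b b' q) \<in> R" for b b' p q
  proof (induction p)
    case 0
    then show ?case by (simp add: op_subst_def psubst_def clinear_0[OF linW] R0)
  next
    case (pCons c p)
    let ?X = "W b b' (op_subst neg_lam_pd p q)"
    have "W b b' (op_subst neg_lam_pd (pCons c p) q) - op_subst pd2 (pCons c p) (W b b' q)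
        = pd2 (?X - op_subst pd2 p (W b b' q)) + D (- ?X)"
      by (simp add: op_subst_def psubst_pCons clinear_neg_lam_pd clinear_pd2 clinear_add[OF linW]
          clinear_scale[OF linW] Wop clinear_diff[OF clinear_pd2] clinear_minus[OF linD])
    then show ?case
      by (simp only:) (intro Radd Rpd RI pCons.IH)
  qed
  \<comment> \<open>The polynomial from the first functional acts through \<open>pd1\<close> on the
    error from the second one, so \<open>R\<close> must be stable under it.\<close>
  have Rpd1: "op_subst pd1 p u \<in> R" if "u \<in> R" for p u
  proof -
    have "D (pd1 v) = pd1 (D v)" for v
      by (simp add: D_def clinear_add[OF clinear_pd1] pd1_pd2 pd1_pd3)
    then have "D (op_subst pd1 p v) = op_subst pd1 p (D v)" for v
      by (rule op_subst_comm[OF linD])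
    from this[symmetric] that show ?thesis
      unfolding R by auto
  qed
  \<comment> \<open>\<open>N\<close> rebuilds a tensor from its pairings with the dual basis. It is
    the identity modulo \<open>R\<close>, yet kills \<open>t\<close> by assumption.\<close>
  define N where "N u = (\<Sum>b\<in>C. \<Sum>b'\<in>C. W b b' (pairing (d b) (d b') u))" for u
  have linN: "clinear N"
    unfolding N_def by (intro clinear_sum_fun clinear_compose[OF linW] clinear_pairing)
  have s1: "op_subst pd1 p (a \<otimes> b \<otimes> c) = dscale p a \<otimes> b \<otimes> c" for p and a b c :: 'a
    using op_subst_comm[of "\<lambda>a. a \<otimes> b \<otimes> c" pd pd1 p a]
    by (simp add: clinear_tens_left pd123_tens) (simp add: op_subst_def dscale_def)
  have s2: "op_subst pd2 p (a \<otimes> b \<otimes> c) = a \<otimes> dscale p b \<otimes> c" for p and a b c :: 'a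
    using op_subst_comm[of "\<lambda>b. a \<otimes> b \<otimes> c" pd pd2 p b]
    by (simp add: clinear_compose[OF clinear_tens_right clinear_tens_left] pd123_tens)
      (simp add: op_subst_def dscale_def)
  have pure: "N (a \<otimes> a' \<otimes> c) - a \<otimes> a' \<otimes> c \<in> R" for a a' c
  proof -
    define p q where "p b = cap (d b) a" and "q b = cap (d b) a'" for b
    have "(\<Sum>b\<in>C. \<Sum>b'\<in>C. dscale (p b) b \<otimes> dscale (q b') b' \<otimes> c)
        = (\<Sum>b\<in>C. dscale (p b) b) \<otimes> (\<Sum>b'\<in>C. dscale (q b') b') \<otimes> c"
      by (simp only: clinear_sum[OF clinear_tens_left]) (simp only: clinear_sum[OF clinear_tens_right])
    \<comment> \<open>Expanding a and a' in the basis writes the pure tensor with p_b in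
      \<open>pd1\<close> and q_b' in \<open>pd2\<close>; \<open>N\<close> differs only in having
      q_b' at -\<lambda>-\<partial> inside \<open>W\<close>, which is the error bounded by
      \<open>Wsub\<close>.\<close>
    then have "N (a \<otimes> a' \<otimes> c) - a \<otimes> a' \<otimes> c = (\<Sum>b\<in>C. \<Sum>b'\<in>C.
        op_subst pd1 (p b) (W b b' (op_subst neg_lam_pd (q b') [:c:]) - op_subst pd2 (q b') (W b b' [:c:])))"
      by (simp add: N_def pairing_tens op_subst_comm[of "W _ _" "pCons 0" pd1, OF linW Wlam] p_def q_def dual
          clinear_diff[OF clinear_op_subst[OF clinear_pd1]] sum_subtractf)
        (simp add: W_def psubst_const clinear_pd1 clinear_0[OF clinear_tens_right] s1 s2)
    then show ?thesis
      by (simp add: Rsum Rpd1 Wsub)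
  qed
  have "N t - t \<in> R"
  proof (induction t rule: tensor_induct)
    case zero
    then show ?case by (simp add: clinear_0[OF linN] R0)
  next
    case (tens a u)
    show ?case
    proof (induction u rule: tensor_induct)
      case zero
      then show ?case by (simp add: clinear_0[OF linN] clinear_0[OF clinear_tens_right] R0)
    next
      case (tens b c)
      then show ?case by (rule pure)
    next
      case (add u v)
      from Radd[OF this] show ?case
        by (simp add: clinear_add[OF clinear_tens_right] clinear_add[OF linN] algebra_simps)
    qed
  next
    case (add u v)
    from Radd[OF this] show ?case
      by (simp add: clinear_add[OF linN] algebra_simps)
  qed
  moreover have "N t = 0"
    by (simp add: N_def zero clinear_0[OF linW])
  \<comment> \<open>With \<open>N t = 0\<close> the congruence says that -t lies in
    \<open>R\<close>; scaling by -1 recovers t.\<close>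
  ultimately have "(-1) *\<^sub>C (- t) \<in> R"
    by (metis Rscale diff_0)
  then show ?thesis
    by (simp add: R_def cvs.scale_minus_left scaleC_one)
qed

theorem theorem6p1:
  fixes lprod :: "'a::dmod \<Rightarrow> 'a \<Rightarrow> 'a poly"
    and r :: "('a, 'a) tensor"
    and n :: nat and x l :: "nat \<Rightarrow> 'a"
  assumes "assoc_conformal_algebra lprod"
    and "\<exists>S::'a set. finite S \<and> dm.span S = UNIV"
    and "\<exists>B::'a set. dm.independent B \<and> dm.span B = UNIV"
    and "r = (\<Sum>i<n. x i \<otimes> l i)"
    and "tensor_swap r = - r"
  shows "acybe lprod n x l \<longleftrightarrow>
    (\<forall>f g :: 'a cdual.
      lprod (T0 n x l f) (T0 n x l g)
      - map_poly (T0 n x l) (dual_act (R_A lprod (T0 n x l f)) g)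
      - map_poly (T0 n x l) (flip (dual_act (L_A lprod (T0 n x l g)) f)) = 0)"
proof -
  obtain S :: "'a set" where S: "finite S" "dm.span S = UNIV"
    using assms(2) by blast
  obtain B :: "'a set" where B: "dm.independent B" "dm.span B = UNIV"
    using assms(3) by blast
  obtain C and d :: "'a \<Rightarrow> 'a cdual"
    where C: "\<And>a. (\<Sum>b\<in>C. dscale (cap (d b) a) b) = a"
    using ex_dual_basis[OF S B] by auto
  interpret assoc_conformal_algebra lprod
    by (rule assms(1))
  \<comment> \<open>Rewriting with this turns the identity into the vanishing of all pairings of r
    \<bullet> r, to be compared with membership in the image of the total derivation.\<close>
  note eq = pairing_bullet[OF S assms(5)[unfolded assms(4)], symmetric]
  show ?thesis
    unfolding acybe_def eq
    by (auto simp: pairing_pd_total intro: in_range_if_pairings_zero[OF C])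
qed

end
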